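(* Let $n\ge1$ and consider a regular solution $h$ to $\partial_t h+G(h)h=0$ defined on $[0,T]$. Then, whenever $\omega$ is a modulus of continuity for $h(0,\cdot)$, $\omega$ is also a modulus of continuity for $h(t,\cdot)$, for any $t\in[0,T]$.
   Context: $\mathbf{T}^n$ is an $n$-dimensional torus, with its standard distance $d$; $\nabla=\nabla_x$. A non-decreasing function $\omega:(0,+\infty)\to(0,+\infty)$ is a modulus of continuity for $f:\mathbf{T}^n\to\mathbf{R}$ if and only if $|f(x_1)-f(x_2)|\le\omega(d(x_1,x_2))$ for all $x_1\neq x_2$ in $\mathbf{T}^n$. Dirichlet to Neumann operator: given $h:\mathbf{T}^n\to\mathbf{R}$, set $\Omega=\{(x,y)\in\mathbf{T}^n\times\mathbf{R}: y<h(x)\}$. For $\psi:\mathbf{T}^n\to\mathbf{R}$, its harmonic extension $\varphi$ is the unique (variational) solution of $\Delta_{x,y}\varphi=0$ in $\Omega$, $\varphi(x,h(x))=\psi(x)$, with $\nabla_{x,y}\varphi\in L^2(\Omega)$. Then $G(h)\psi(x)=(\partial_y\varphi)(x,h(x))-\nabla h(x)\cdot(\nabla\varphi)(x,h(x))$. When $h,\psi$ depend on time $t$, $G(h)\psi$ is computed at each fixed $t$. Regular solution on $[0,T]$: a solution $h$ of $\partial_t h+G(h)h=0$ such that, for some $s>n/2+1$, $h\in C^0([0,T];H^s(\mathbf{T}^n))\cap C^1([0,T];H^{s-1}(\mathbf{T}^n))\cap L^2([0,T];H^{s+1/2}(\mathbf{T}^n))$ and $h\in C^\infty((0,T]\times\mathbf{T}^n)$.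 *)

theory Defs
  imports "HOL-Analysis.Analysis"
begin

section \<open>The torus\<close>

text \<open>
  The torus is $(\mathbf{R} / 2\pi\mathbf{Z})^n$, with $n$ the cardinality of the index type
  \<^typ>\<open>'n\<close>. Functions on it are functions on \<^typ>\<open>real^'n\<close> invariant under the
  lattice of periods, and two vectors represent the same point of the torus iff their difference
  lies in that lattice.
\<close>

definition lattice_vec :: "int^'n \<Rightarrow> real^'n" where
  "lattice_vec k = (\<chi> i. 2 * pi * of_int (k $ i))"

definition torus_eq :: "real^'n \<Rightarrow> real^'n \<Rightarrow> bool" where
  "torus_eq x y \<longleftrightarrow> x - y \<in> range lattice_vec"

definition torus_dist :: "real^'n \<Rightarrow> real^'n \<Rightarrow> real" where
  "torus_dist x y = (INF k. norm (x - y - lattice_vec k))"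

definition torus_periodic :: "(real^'n \<Rightarrow> 'b) \<Rightarrow> bool" where
  "torus_periodic f \<longleftrightarrow> (\<forall>x k. f (x + lattice_vec k) = f x)"

definition torus_cell :: "(real^'n) set" where
  "torus_cell = {x. \<forall>i. 0 \<le> x $ i \<and> x $ i \<le> 2 * pi}"

text \<open>A modulus is a function on $(0,+\infty)$; its values elsewhere are irrelevant.\<close>

definition modulus_of_continuity :: "(real \<Rightarrow> real) \<Rightarrow> (real^'n \<Rightarrow> real) \<Rightarrow> bool" where
  "modulus_of_continuity \<omega> f \<longleftrightarrow>
     mono_on {0<..} \<omega> \<and> (\<forall>r>0. 0 < \<omega> r) \<and>
     (\<forall>x\<^sub>1 x\<^sub>2. \<not> torus_eq x\<^sub>1 x\<^sub>2 \<longrightarrow> \<bar>f x\<^sub>1 - f x\<^sub>2\<bar> \<le> \<omega> (torus_dist x\<^sub>1 x\<^sub>2))"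


section \<open>Differential calculus\<close>

text \<open>
  Derivatives are taken within \<open>S\<close>, so that they are one-sided at boundary points belonging to
  \<open>S\<close>. This is only meant for sets on which they are unique, such as open sets and convex sets
  with nonempty interior.
\<close>

primrec Ck_on :: "nat \<Rightarrow> 'a::euclidean_space set \<Rightarrow> ('a \<Rightarrow> real) \<Rightarrow> bool" where
  "Ck_on 0 S f \<longleftrightarrow> continuous_on S f"
| "Ck_on (Suc k) S f \<longleftrightarrow>
     (\<exists>f'. (\<forall>x\<in>S. (f has_derivative f' x) (at x within S)) \<and>
           (\<forall>b\<in>Basis. Ck_on k S (\<lambda>x. f' x b)))"

definition smooth_on :: "'a::euclidean_space set \<Rightarrow> ('a \<Rightarrow> real) \<Rightarrow> bool" where
  "smooth_on S f \<longleftrightarrow> (\<forall>k. Ck_on k S f)"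

definition partial_deriv :: "'a::euclidean_space \<Rightarrow> ('a \<Rightarrow> real) \<Rightarrow> 'a \<Rightarrow> real" where
  "partial_deriv b f z = deriv (\<lambda>r. f (z + r *\<^sub>R b)) 0"

definition gradient :: "('a::euclidean_space \<Rightarrow> real) \<Rightarrow> 'a \<Rightarrow> 'a" where
  "gradient f z = (\<Sum>b\<in>Basis. partial_deriv b f z *\<^sub>R b)"

definition laplacian :: "('a::euclidean_space \<Rightarrow> real) \<Rightarrow> 'a \<Rightarrow> real" where
  "laplacian f z = (\<Sum>b\<in>Basis. partial_deriv b (partial_deriv b f) z)"


section \<open>The Dirichlet to Neumann operator\<close>

definition fluid_domain :: "(real^'n \<Rightarrow> real) \<Rightarrow> ((real^'n) \<times> real) set" where
  "fluid_domain h = {(x, y). y < h x}"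

definition closed_fluid_domain :: "(real^'n \<Rightarrow> real) \<Rightarrow> ((real^'n) \<times> real) set" where
  "closed_fluid_domain h = {(x, y). y \<le> h x}"

text \<open>
  By Weyl's lemma a variational solution is a classical solution inside the domain; its boundary
  value is attained continuously here, which is the usual trace for the continuous \<open>h\<close> and
  \<open>\<psi>\<close> under consideration. The values of \<open>\<phi>\<close> above the graph of \<open>h\<close> are irrelevant.
  Square integrability over the domain in $\mathbf{T}^n \times \mathbf{R}$ is square integrability
  over one period cell; it selects the solution by excluding the addition of multiples of harmonic
  functions growing as $y \to -\infty$.
\<close>

definition harmonic_extension ::
  "(real^'n \<Rightarrow> real) \<Rightarrow> (real^'n \<Rightarrow> real) \<Rightarrow> ((real^'n) \<times> real \<Rightarrow> real) \<Rightarrow> bool" where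
  "harmonic_extension h \<psi> \<phi> \<longleftrightarrow>
     (\<forall>y. torus_periodic (\<lambda>x. \<phi> (x, y))) \<and>
     continuous_on (closed_fluid_domain h) \<phi> \<and>
     Ck_on 2 (fluid_domain h) \<phi> \<and>
     (\<forall>z\<in>fluid_domain h. laplacian \<phi> z = 0) \<and>
     (\<forall>x. \<phi> (x, h x) = \<psi> x) \<and>
     set_integrable lebesgue (fluid_domain h \<inter> torus_cell \<times> UNIV) (\<lambda>z. (norm (gradient \<phi> z))\<^sup>2)"

text \<open>
  \<open>has_DN h \<psi> g\<close> reads: $G(h)\psi$ is defined and equal to \<open>g\<close>. At the boundary point
  $(x, h(x))$ the derivatives of \<open>\<phi>\<close> are taken from inside the domain, with \<open>p\<close> the
  horizontal gradient and \<open>q\<close> the vertical derivative; they are unique as \<open>h\<close> is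
  differentiable at \<open>x\<close>.
\<close>

definition has_DN ::
  "(real^'n \<Rightarrow> real) \<Rightarrow> (real^'n \<Rightarrow> real) \<Rightarrow> (real^'n \<Rightarrow> real) \<Rightarrow> bool" where
  "has_DN h \<psi> g \<longleftrightarrow>
     (\<exists>\<phi>. harmonic_extension h \<psi> \<phi> \<and>
       (\<forall>x. \<exists>p q grad_h.
          (GDERIV h x :> grad_h) \<and>
          (\<phi> has_derivative (\<lambda>w. (p, q) \<bullet> w)) (at (x, h x) within closed_fluid_domain h) \<and>
          g x = q - grad_h \<bullet> p))"


section \<open>Sobolev spaces on the torus\<close>

definition fourier_coeff :: "(real^'n \<Rightarrow> real) \<Rightarrow> int^'n \<Rightarrow> complex" where
  "fourier_coeff f k =
     (1 / (2 * pi) ^ CARD('n)) *\<^sub>R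
     (LINT x:torus_cell|lebesgue. cis (- (\<Sum>i\<in>UNIV. of_int (k $ i) * x $ i)) * of_real (f x))"

definition sobolev_term :: "real \<Rightarrow> (real^'n \<Rightarrow> real) \<Rightarrow> int^'n \<Rightarrow> real" where
  "sobolev_term s f k =
     (1 + (\<Sum>i\<in>UNIV. (of_int (k $ i))\<^sup>2)) powr s * (norm (fourier_coeff f k))\<^sup>2"

text \<open>
  The space $H^s(\mathbf{T}^n)$ for $s \ge 0$, as a set of square integrable functions rather than
  of almost everywhere classes.
\<close>

definition sobolev :: "real \<Rightarrow> (real^'n \<Rightarrow> real) set" where
  "sobolev s = {f. torus_periodic f \<and>
     set_borel_measurable lebesgue torus_cell f \<and>
     set_integrable lebesgue torus_cell (\<lambda>x. (f x)\<^sup>2) \<and>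
     sobolev_term s f summable_on UNIV}"

definition sobolev_norm :: "real \<Rightarrow> (real^'n \<Rightarrow> real) \<Rightarrow> real" where
  "sobolev_norm s f = sqrt (\<Sum>\<^sub>\<infinity>k. sobolev_term s f k)"

definition C0_sobolev :: "real \<Rightarrow> real set \<Rightarrow> (real \<Rightarrow> real^'n \<Rightarrow> real) \<Rightarrow> bool" where
  "C0_sobolev s I u \<longleftrightarrow>
     (\<forall>t\<in>I. u t \<in> sobolev s) \<and>
     (\<forall>t\<in>I. ((\<lambda>\<tau>. sobolev_norm s (\<lambda>x. u \<tau> x - u t x)) \<longlongrightarrow> 0) (at t within I))"

definition C1_sobolev :: "real \<Rightarrow> real set \<Rightarrow> (real \<Rightarrow> real^'n \<Rightarrow> real) \<Rightarrow> bool" where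
  "C1_sobolev s I u \<longleftrightarrow>
     C0_sobolev s I u \<and>
     (\<exists>u'. C0_sobolev s I u' \<and>
       (\<forall>t\<in>I. ((\<lambda>\<tau>. sobolev_norm s (\<lambda>x. (u \<tau> x - u t x) / (\<tau> - t) - u' t x)) \<longlongrightarrow> 0)
                (at t within I)))"

text \<open>
  As $H^s(\mathbf{T}^n)$ is a separable Hilbert space, a map into it is (strongly) measurable iff all
  its Fourier coefficients are, by Pettis' theorem.
\<close>

definition L2_sobolev :: "real \<Rightarrow> real set \<Rightarrow> (real \<Rightarrow> real^'n \<Rightarrow> real) \<Rightarrow> bool" where
  "L2_sobolev s I u \<longleftrightarrow>
     (AE t in lebesgue_on I. u t \<in> sobolev s) \<and>
     (\<forall>k. (\<lambda>t. fourier_coeff (u t) k) \<in> borel_measurable (lebesgue_on I)) \<and>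
     integrable (lebesgue_on I) (\<lambda>t. (sobolev_norm s (u t))\<^sup>2)"


section \<open>Regular solutions\<close>

text \<open>
  As $s > n/2 + 1$, each $h(t,\cdot)$ has a continuous representative, which is the one meant here.
\<close>

definition regular_solution :: "real \<Rightarrow> (real \<Rightarrow> real^'n \<Rightarrow> real) \<Rightarrow> bool" where
  "regular_solution T h \<longleftrightarrow>
     (\<forall>t\<in>{0..T}. torus_periodic (h t) \<and> continuous_on UNIV (h t)) \<and>
     (\<exists>s. s > CARD('n) / 2 + 1 \<and>
        C0_sobolev s {0..T} h \<and>
        C1_sobolev (s - 1) {0..T} h \<and>
        L2_sobolev (s + 1/2) {0..T} h) \<and>
     smooth_on ({0<..T} \<times> UNIV) (\<lambda>(t, x). h t x) \<and>
     (\<forall>t\<in>{0..T}. \<exists>g. has_DN (h t) (h t) g \<and>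
        (\<forall>x. \<exists>dh. ((\<lambda>\<tau>. h \<tau> x) has_real_derivative dh) (at t within {0..T}) \<and>
                  dh + g x = 0))"

end

theory Submission
  imports Defs
begin

text \<open>
  A maximum principle in time for the increments $h(t,x+v) - h(t,x)$ with $v$ fixed: their supremum
  over $x$ does not increase with $t$. Applied to $v$ and $-v$ with the bound $\omega(d(x+v,x))$ at time
  $0$, this is the assertion.

  Suppose that $h(t,x+v) - h(t,x) - \epsilon t$ is maximal over $[0,T] \times \mathbf{T}^n$ at a
  point $(t_0,x_0)$ with $t_0 > 0$. The time derivative of $h(t,x_0+v) - h(t,x_0)$ is then at least
  $\epsilon$ at $t_0$, whereas the equation makes it equal to $G(h)h(x_0) - G(h)h(x_0+v)$. So it is
  enough to prove $G(h)h(x_0) \le G(h)h(x_0+v)$ when the increment of $h$ by $v$ is maximal at $x_0$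
  (\<open>DN_le_at_maximal_increment\<close>). Let $M$ be that maximum. The graph of $h_2 = h + M$ lies above the
  graph of $h_1 = h(\cdot+v)$ and touches it at $x_0$. Translations carry the extension
  $\varphi$ of $h$ to extensions $\varphi_i$ of $h_i$ in the domains $\Omega_1 \subseteq \Omega_2$
  below the two graphs. First, $\varphi_2 \ge y$ in $\Omega_2$: the two sides agree on the graph of
  $h_2$, and $-y$ tends to $+\infty$ at the bottom (this is positivity of the pressure). Hence
  $\varphi_2 \ge y = \varphi_1$ on the graph of $h_1$, and therefore $\varphi_2 \ge \varphi_1$ in
  $\Omega_1$. Both functions take the same value at the contact point, where the two graphs have the
  same normal, so that the comparison of the normal derivatives is the one sought
  (\<open>DN_comparison_at_contact\<close>).

  Both inequalities rest on \<open>minimum_principle\<close>, where the square integrability of the gradient has to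
  exclude growth as $y \to -\infty$. It is used in an averaged form that involves no
  interior estimate: for a convex decreasing function $A$ of linear growth that vanishes on
  $[-\epsilon,\infty)$, the function $A(u)$, extended by $0$ above the graph, is subharmonic on
  the whole of $\mathbf{T}^n \times \mathbf{R}$. Its mean $m(y)$ over the horizontal slice at height
  $y$ is therefore convex. It vanishes for large $y$, and
  its slope tends to $0$ along a sequence $y \to -\infty$ because the vertical derivative of the
  harmonic function is square integrable there. Thus $m = 0$, that is $u \ge -\epsilon$.

  Attaining the maximum requires $h$ to be continuous on $[0,T] \times \mathbf{T}^n$ up to the
  initial time. This follows from continuity in time with values in $H^s$ and the
  bound of the supremum by the $H^s$ norm for $s > n/2$ (\<open>sobolev_sup_bound\<close>). The latter reduces, by the
  Cauchy-Schwarz inequality, to the fact that a continuous function is bounded by the sum of the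
  moduli of its Fourier coefficients (\<open>fourier_sum_bounds_function\<close>). This is obtained by testing
  with powers of the trigonometric polynomial $\sum_i (1 + \cos(x_i - x_{0,i}))$, which concentrate
  at $x_0$.
\<close>

section \<open>Functions on the torus and integrals over a period cell\<close>

lemma torus_cell_eq_cbox: "torus_cell = cbox 0 (\<chi> i. 2 * pi)"
  by (auto simp: torus_cell_def mem_box_cart)

lemma torus_periodicD: "torus_periodic f \<Longrightarrow> f (x + lattice_vec k) = f x"
  by (simp add: torus_periodic_def)

lemma lattice_vec_axis: "lattice_vec (axis i m) = axis i (2 * pi * of_int m)"
  by (auto simp: lattice_vec_def axis_def vec_eq_iff)

lemma axis_eq_scaleR: "axis i r = r *\<^sub>R (axis i 1 :: real^'n)"
  by (auto simp: axis_def vec_eq_iff)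

text \<open>
  The part of the shifted cell that sticks out of the cell is a slab, and a period carries it onto
  the slab that the shifted cell misses.
\<close>

lemma integral_torus_cell_shift_axis_small:
  fixes f :: "real^'n \<Rightarrow> 'b::euclidean_space"
  assumes cont: "continuous_on UNIV f" and per: "torus_periodic f" and c: "0 \<le> c" "c \<le> 2 * pi"
  shows "integral torus_cell (\<lambda>x. f (x + axis i c)) = integral torus_cell f"
proof -
  define b :: "real^'n" where "b = (\<chi> j. 2 * pi)"
  define v :: "real^'n" where "v = axis i c"
  define w :: "real^'n" where "w = axis i (2 * pi)"
  have int: "f integrable_on cbox p q" for p q
    by (intro integrable_continuous continuous_on_subset[OF cont]) auto
  have e: "x \<bullet> axis i 1 = x $ i" for x :: "real^'n" by (simp add: inner_axis)
  have fw: "f (x + w) = f x" for x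
    using torus_periodicD[OF per, of x "axis i 1"] by (simp add: lattice_vec_axis w_def)
  define lo where "lo = cbox 0 b \<inter> {x. x $ i \<le> c}"
  define hi where "hi = cbox 0 b \<inter> {x. x $ i \<ge> c}"
  define d :: "real^'n" where "d = (\<chi> j. if j = i then c else 2 * pi)"
  have all_split: "(\<forall>j. R j) \<longleftrightarrow> R i \<and> (\<forall>j. j \<noteq> i \<longrightarrow> R j)" for R by metis
  have vi: "v $ i = c" "w $ i = 2 * pi" "d $ i = c" "b $ i = 2 * pi"
    and vj: "j \<noteq> i \<Longrightarrow> v $ j = 0" "j \<noteq> i \<Longrightarrow> w $ j = 0" "j \<noteq> i \<Longrightarrow> d $ j = 2 * pi"
      "j \<noteq> i \<Longrightarrow> b $ j = 2 * pi" for j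
    by (simp_all add: v_def w_def d_def b_def axis_def)
  have mem: "x \<in> cbox p q \<longleftrightarrow> p $ i \<le> x $ i \<and> x $ i \<le> q $ i \<and>
      (\<forall>j. j \<noteq> i \<longrightarrow> p $ j \<le> x $ j \<and> x $ j \<le> q $ j)" for p q x :: "real^'n"
    unfolding mem_box_cart using all_split[of "\<lambda>j. p $ j \<le> x $ j \<and> x $ j \<le> q $ j"] by simp
  have lo: "lo = cbox 0 d"
    using c by (auto simp: lo_def mem vi vj)
  have P: "cbox v (b + v) \<inter> {x. x $ i \<le> 2 * pi} = hi"
    using c by (auto simp: hi_def mem vi vj)
  have Q: "cbox v (b + v) \<inter> {x. x $ i \<ge> 2 * pi} = cbox w (d + w)"
    using c by (auto simp: mem vi vj)
  have "integral torus_cell (\<lambda>x. f (x + v)) = integral (cbox v (b + v)) f"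
    using integral_shift_cbox[of v v "b + v" f] by (simp add: torus_cell_eq_cbox b_def)
  also have "\<dots> = integral hi f + integral (cbox w (d + w)) f"
    using integral_split[OF int, of "axis i 1" v "b + v" "2 * pi"] unfolding e P Q by simp
  also have "integral (cbox w (d + w)) f = integral lo f"
    using integral_shift_cbox[of w w "d + w" f] by (simp add: lo fw)
  also have "integral hi f + integral lo f = integral torus_cell f"
    using integral_split[OF int, of "axis i 1" 0 b c] unfolding e
    by (simp add: torus_cell_eq_cbox b_def lo_def hi_def)
  finally show ?thesis by (simp add: v_def)
qed

lemma integral_torus_cell_shift_axis:
  fixes f :: "real^'n \<Rightarrow> 'b::euclidean_space"
  assumes cont: "continuous_on UNIV f" and per: "torus_periodic f"
  shows "integral torus_cell (\<lambda>x. f (x + axis i c)) = integral torus_cell f"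
proof -
  define m where "m = \<lfloor>c / (2 * pi)\<rfloor>"
  define r where "r = c - 2 * pi * m"
  have "m \<le> c / (2 * pi)" "c / (2 * pi) < m + 1" unfolding m_def by linarith+
  then have r: "0 \<le> r" "r \<le> 2 * pi" by (auto simp: r_def field_simps)
  have "axis i c = axis i r + lattice_vec (axis i m)"
    by (simp add: lattice_vec_axis r_def axis_eq_scaleR[of i "_ * _"] axis_eq_scaleR[of i c]
        axis_eq_scaleR[of i "_ - _"] scaleR_left_diff_distrib)
  then have "f (x + axis i c) = f (x + axis i r)" for x
    using torus_periodicD[OF per, of "x + axis i r"] by (simp add: add.assoc)
  then show ?thesis using integral_torus_cell_shift_axis_small[OF cont per r] by simp
qed

lemma torus_periodic_shift: "torus_periodic f \<Longrightarrow> torus_periodic (\<lambda>x. f (x + v))"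
  unfolding torus_periodic_def by (metis add.assoc add.commute)

lemma integral_torus_cell_shift:
  fixes f :: "real^'n \<Rightarrow> 'b::euclidean_space"
  assumes cont: "continuous_on UNIV f" and per: "torus_periodic f"
  shows "integral torus_cell (\<lambda>x. f (x + v)) = integral torus_cell f"
proof -
  have "integral torus_cell (\<lambda>x. f (x + (\<Sum>i\<in>I. axis i (v $ i)))) = integral torus_cell f"
    if "finite I" for I
    using that
  proof (induction I rule: finite_induct)
    case (insert i I)
    have "integral torus_cell (\<lambda>x. f ((x + axis i (v $ i)) + (\<Sum>i\<in>I. axis i (v $ i)))) 
       = integral torus_cell (\<lambda>x. f (x + (\<Sum>i\<in>I. axis i (v $ i))))"
      by (rule integral_torus_cell_shift_axis[where f = "\<lambda>x. f (x + (\<Sum>i\<in>I. axis i (v $ i)))"])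
         (auto intro!: torus_periodic_shift per continuous_on_compose2[OF cont] continuous_intros)
    then show ?case using insert by (simp add: add_ac)
  qed simp
  moreover have "(\<Sum>i\<in>UNIV. axis i (v $ i)) = v"
    by (simp add: vec_eq_iff axis_def if_distrib cong: if_cong)
  ultimately show ?thesis by (metis finite)
qed

text \<open>
  The integral of $f(\cdot + r e_i)$ over the cell does not depend on $r$, and its derivative with
  respect to $r$ is the integral of the partial derivative. This is integration by parts on the torus.
\<close>

lemma integral_torus_cell_derivative_axis:
  fixes f g :: "real^'n \<Rightarrow> real"
  assumes contf: "continuous_on UNIV f" and per: "torus_periodic f" and contg: "continuous_on UNIV g"
    and deriv: "\<And>x. ((\<lambda>r. f (x + axis i r)) has_real_derivative g x) (at 0)"
  shows "integral torus_cell g = 0"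
proof -
  have ax: "continuous_on UNIV (\<lambda>p. snd p + axis i (fst p :: real))"
    unfolding axis_eq_scaleR[of i "fst p" for p] by (intro continuous_intros)
  have der: "((\<lambda>r. f (x + axis i r)) has_real_derivative g (x + axis i c)) (at c)" for x c
  proof -
    have "axis i (r + c) = axis i r + (axis i c :: real^'n)" for r by (auto simp: axis_def vec_eq_iff)
    then show ?thesis using deriv[of "x + axis i c"] DERIV_shift[of "\<lambda>r. f (x + axis i r)" "g (x + axis i c)" 0 c]
      by (simp add: add_ac)
  qed
  have "((\<lambda>r. integral torus_cell (\<lambda>x. f (x + axis i r))) has_real_derivative
     integral torus_cell (\<lambda>x. g (x + axis i 0))) (at 0 within UNIV)"
    unfolding torus_cell_eq_cbox
  proof (rule leibniz_rule_field_derivative)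
    show "continuous_on (UNIV \<times> cbox 0 (\<chi> i. 2 * pi)) (\<lambda>(r, x). g (x + axis i r))"
      unfolding case_prod_unfold
      by (rule continuous_on_compose2[OF contg continuous_on_subset[OF ax]]) auto
    show "(\<lambda>x. f (x + axis i r)) integrable_on cbox 0 (\<chi> i. 2 * pi)" for r
      by (intro integrable_continuous continuous_on_compose2[OF contf] continuous_intros) auto
  qed (auto intro: der)
  moreover have "integral torus_cell (\<lambda>x. f (x + axis i r)) = integral torus_cell f" for r
    by (rule integral_torus_cell_shift_axis[OF contf per])
  moreover have "axis i 0 = (0::real^'n)" by (auto simp: axis_def vec_eq_iff)
  ultimately have "((\<lambda>r::real. integral torus_cell f) has_real_derivative integral torus_cell g) (at 0)"
    by simp
  then show ?thesis by (metis DERIV_const DERIV_unique)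
qed

lemma torus_cell_representative: "\<exists>k. x + lattice_vec k \<in> torus_cell" for x :: "real^'n"
proof -
  define k :: "int^'n" where "k = (\<chi> i. - \<lfloor>x $ i / (2 * pi)\<rfloor>)"
  have "0 \<le> (x + lattice_vec k) $ i \<and> (x + lattice_vec k) $ i \<le> 2 * pi" for i
  proof -
    define m where "m = \<lfloor>x $ i / (2 * pi)\<rfloor>"
    have "m \<le> x $ i / (2 * pi)" "x $ i / (2 * pi) \<le> m + 1"
      unfolding m_def by linarith+
    then have "2 * pi * m \<le> x $ i" "x $ i \<le> 2 * pi * m + 2 * pi" by (simp_all add: field_simps)
    moreover have "(x + lattice_vec k) $ i = x $ i - 2 * pi * m" by (simp add: lattice_vec_def k_def m_def)
    ultimately show ?thesis by simp
  qed
  then show ?thesis unfolding torus_cell_def by blast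
qed

lemma torus_periodic_attains_bounds:
  fixes f :: "real^'n \<Rightarrow> real"
  assumes "continuous_on UNIV f" and per: "torus_periodic f"
  obtains x\<^sub>0 x\<^sub>1 where "\<And>x. f x\<^sub>0 \<le> f x" "\<And>x. f x \<le> f x\<^sub>1"
proof -
  have c: "compact (torus_cell :: (real^'n) set)" "torus_cell \<noteq> ({} :: (real^'n) set)"
    "continuous_on torus_cell f"
    using torus_cell_representative continuous_on_subset[OF assms(1)]
    by (auto simp: torus_cell_eq_cbox)
  obtain x0 where x0: "x0 \<in> torus_cell" "\<forall>x\<in>torus_cell. f x0 \<le> f x"
    using continuous_attains_inf[OF c] by blast
  obtain x1 where x1: "x1 \<in> torus_cell" "\<forall>x\<in>torus_cell. f x \<le> f x1"
    using continuous_attains_sup[OF c] by blast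
  have "f x0 \<le> f x" "f x \<le> f x1" for x
    using torus_cell_representative[of x] x0 x1 torus_periodicD[OF per] by metis+
  then show thesis by (rule that)
qed


section \<open>A minimum principle below the free surface\<close>

text \<open>
  The truncated functions below vanish near the free surface, so that extending them by zero keeps
  their regularity and integration takes place over whole horizontal slices.
\<close>

lemma zero_extension_continuous:
  fixes f :: "'a::real_normed_vector \<Rightarrow> real"
  assumes "open S" "continuous_on S f"
    and "\<And>z. z \<notin> S \<Longrightarrow> \<forall>\<^sub>F w in nhds z. w \<in> S \<longrightarrow> f w = 0"
  shows "continuous_on UNIV (\<lambda>w. if w \<in> S then f w else 0)"
  unfolding continuous_on_eq_continuous_at[OF open_UNIV]
proof
  fix z
  show "isCont (\<lambda>w. if w \<in> S then f w else 0) z"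
  proof (cases "z \<in> S")
    case True
    then have "isCont f z" using assms(1,2) by (simp add: continuous_on_eq_continuous_at)
    moreover have "\<forall>\<^sub>F w in nhds z. (if w \<in> S then f w else 0) = f w"
      using eventually_nhds_in_open[OF assms(1) True] by eventually_elim simp
    ultimately show ?thesis by (simp add: isCont_cong)
  next
    case False
    have "\<forall>\<^sub>F w in nhds z. (if w \<in> S then f w else 0) = 0"
      using assms(3)[OF False] by eventually_elim simp
    then show ?thesis using isCont_cong[where g = "\<lambda>_. 0"] by fastforce
  qed
qed

lemma zero_extension_has_derivative:
  fixes f :: "'a::real_normed_vector \<Rightarrow> real"
  assumes "open S" "\<And>z. z \<in> S \<Longrightarrow> (f has_derivative f' z) (at z)"
    and "\<And>z. z \<notin> S \<Longrightarrow> \<forall>\<^sub>F w in nhds z. w \<in> S \<longrightarrow> f w = 0"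
  shows "((\<lambda>w. if w \<in> S then f w else 0) has_derivative (\<lambda>c. if z \<in> S then f' z c else 0)) (at z)"
proof (cases "z \<in> S")
  case True
  show ?thesis
    using has_derivative_transform_within_open[OF assms(2)[OF True] assms(1) True] True by simp
next
  case False
  have "\<forall>\<^sub>F w in nhds z. (if w \<in> S then f w else 0) = 0"
    using assms(3)[OF False] by eventually_elim simp
  then obtain U where U: "open U" "z \<in> U" "\<And>w. w \<in> U \<Longrightarrow> (if w \<in> S then f w else 0) = 0"
    unfolding eventually_nhds by blast
  have "((\<lambda>w. 0::real) has_derivative (\<lambda>c. 0)) (at z)" by simp
  from has_derivative_transform_within_open[OF this U(1,2)] U(3) False
  show ?thesis by simp
qed

lemma DERIV_zero_on_left:
  fixes g g' :: "real \<Rightarrow> real"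
  assumes d: "\<And>r. (g has_real_derivative g' r) (at r)" and "g 0 = 0" "g' 0 = 0"
  shows "((\<lambda>r. if r \<le> 0 then 0 else g r) has_real_derivative (if r \<le> 0 then 0 else g' r)) (at r)"
proof -
  consider "r < 0" | "r > 0" | "r = 0" by linarith
  then show ?thesis
  proof cases
    case 1
    have "((\<lambda>r. 0) has_real_derivative 0) (at r)" by simp
    from has_field_derivative_transform_within_open[OF this, of "{..<0}" "\<lambda>r. if r \<le> 0 then 0 else g r"] 1
    show ?thesis by simp
  next
    case 2
    from has_field_derivative_transform_within_open[OF d, of "{0<..}" r "\<lambda>r. if r \<le> 0 then 0 else g r"] 2
    show ?thesis by simp
  next
    case 3
    have lim: "((\<lambda>h. g h / h) \<longlongrightarrow> 0) (at 0)" using d[of 0] assms by (simp add: DERIV_def)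
    have "norm ((if h \<le> 0 then 0 else g h) / h) \<le> \<bar>g h / h\<bar>" for h
      by (auto simp del: abs_divide)
    then have "((\<lambda>h. (if h \<le> 0 then 0 else g h) / h) \<longlongrightarrow> 0) (at 0)"
      by (intro Lim_null_comparison[OF _ tendsto_rabs_zero[OF lim]] always_eventually) blast
    then show ?thesis using 3 by (simp add: DERIV_def cong: if_cong)
  qed
qed

text \<open>
  A smoothed version $A(u)$ of the negative part of $u + \epsilon$: it is twice continuously
  differentiable and convex, which makes $A(u)$ subharmonic, and its slope is bounded, so
  that the gradient of $A(u)$ is controlled by that of $u$. The function $r - \arctan r$ has these
  properties for $r \ge 0$ and vanishes to third order at $0$.
\<close>

lemma smooth_negative_part_exists:
  fixes \<epsilon> :: real
  obtains A A1 A2 :: "real \<Rightarrow> real"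
  where "\<And>s. (A has_real_derivative A1 s) (at s)" "\<And>s. (A1 has_real_derivative A2 s) (at s)"
    "continuous_on UNIV A2" "\<And>s. -1 \<le> A1 s" "\<And>s. A1 s \<le> 0" "\<And>s. 0 \<le> A2 s" "\<And>s. 0 \<le> A s"
    "\<And>s. s \<ge> -\<epsilon> \<Longrightarrow> A s = 0" "\<And>s. s \<ge> -\<epsilon> \<Longrightarrow> A1 s = 0" "\<And>s. s \<ge> -\<epsilon> \<Longrightarrow> A2 s = 0"
    "\<And>s. s < -\<epsilon> \<Longrightarrow> A s > 0"
proof -
  define B B1 B2 :: "real \<Rightarrow> real" where
    "B = (\<lambda>r. if r \<le> 0 then 0 else r - arctan r)" and
    "B1 = (\<lambda>r. if r \<le> 0 then 0 else r\<^sup>2 / (1 + r\<^sup>2))" and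
    "B2 = (\<lambda>r. if r \<le> 0 then 0 else 2 * r / (1 + r\<^sup>2)\<^sup>2)"
  have pos: "1 + r\<^sup>2 > 0" "1 + r\<^sup>2 \<noteq> 0" for r :: real
    using zero_le_power2[of r] by linarith+
  have dB: "(B has_real_derivative B1 r) (at r)" for r
    unfolding B_def B1_def
    by (rule DERIV_zero_on_left) (use pos in \<open>auto intro!: derivative_eq_intros simp: field_simps\<close>)
  have dB1: "(B1 has_real_derivative B2 r) (at r)" for r
    unfolding B1_def B2_def
    by (rule DERIV_zero_on_left)
      (use pos in \<open>auto intro!: derivative_eq_intros simp: field_simps power2_eq_square\<close>)
  have sh: "((\<lambda>s. - \<epsilon> - s) has_real_derivative -1) (at s)" for s :: real
    by (auto intro!: derivative_eq_intros)
  have cB2: "continuous_on UNIV B2"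
  proof -
    have "continuous_on ({..0} \<union> {0..}) B2"
      unfolding B2_def
      by (intro continuous_on_If) (use pos in \<open>auto intro!: continuous_intros\<close>)
    moreover have "{..0} \<union> {0..} = (UNIV :: real set)" by auto
    ultimately show ?thesis by simp
  qed
  have "arctan r < r" if "r > 0" for r :: real
  proof -
    have "\<exists>z>0. z < r \<and> arctan r - arctan 0 = (r - 0) * inverse (1 + z\<^sup>2)"
      by (rule MVT2[OF that]) (rule DERIV_arctan)
    then obtain z where "0 < z" "z < r" "arctan r - arctan 0 = (r - 0) * inverse (1 + z\<^sup>2)"
      by blast
    moreover have "r * inverse (1 + z\<^sup>2) < r * 1"
      using that \<open>0 < z\<close> pos[of z] by (intro mult_strict_left_mono) (auto simp: field_simps)
    ultimately show ?thesis by simp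
  qed
  then have "B r > 0" if "r > 0" for r using that by (simp add: B_def)
  moreover have "B r \<ge> 0" for r using \<open>\<And>r. 0 < r \<Longrightarrow> B r > 0\<close>[of r] by (cases "r > 0") (auto simp: B_def)
  moreover have "0 \<le> B1 r" "B1 r \<le> 1" "0 \<le> B2 r" "r \<le> 0 \<Longrightarrow> B r = 0" "r \<le> 0 \<Longrightarrow> B1 r = 0"
      "r \<le> 0 \<Longrightarrow> B2 r = 0" for r
    using pos[of r] by (auto simp: B_def B1_def B2_def)
  moreover have "((\<lambda>s. B (-\<epsilon> - s)) has_real_derivative - B1 (-\<epsilon> - s)) (at s)"
    "((\<lambda>s. - B1 (-\<epsilon> - s)) has_real_derivative B2 (-\<epsilon> - s)) (at s)" for s
    using DERIV_chain2[OF dB sh] DERIV_minus[OF DERIV_chain2[OF dB1 sh]] by simp_all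
  moreover have "continuous_on UNIV (\<lambda>s. B2 (-\<epsilon> - s))"
    by (rule continuous_on_compose2[OF cB2]) (auto intro: continuous_intros)
  ultimately show thesis
    by (intro that[of "\<lambda>s. B (-\<epsilon> - s)" "\<lambda>s. - B1 (-\<epsilon> - s)" "\<lambda>s. B2 (-\<epsilon> - s)"]) auto
qed

lemma sum_Basis_slab:
  fixes f :: "(real^'n) \<times> real \<Rightarrow> real"
  shows "(\<Sum>b\<in>Basis. f b) = (\<Sum>i\<in>UNIV. f (axis i 1, 0)) + f (0, 1)"
proof -
  have B: "(Basis :: ((real^'n) \<times> real) set) = range (\<lambda>i. (axis i 1, 0)) \<union> {(0, 1)}"
    by (auto simp: Basis_prod_def Basis_vec_def)
  have "inj (\<lambda>i. (axis i 1 :: real^'n, 0 :: real))" by (auto simp: inj_on_def axis_eq_axis)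
  then show ?thesis
    unfolding B by (subst sum.union_disjoint) (auto simp: sum.reindex)
qed

lemma vertical_in_Basis: "(0, 1) \<in> (Basis :: ((real^'n) \<times> real) set)"
  and horizontal_in_Basis: "(axis i 1, 0) \<in> (Basis :: ((real^'n) \<times> real) set)"
  by (auto simp: Basis_prod_def Basis_vec_def)

lemma continuous_on_slice:
  assumes "continuous_on UNIV (k :: 'a::topological_space \<times> 'b::topological_space \<Rightarrow> 'c::topological_space)"
  shows "continuous_on S (\<lambda>x. k (x, y))"
  by (rule continuous_on_compose2[OF assms]) (auto intro: continuous_intros)

lemma slice_integral_has_derivative:
  fixes k :: "(real^'n) \<times> real \<Rightarrow> real"
  assumes d: "\<And>z. (k has_derivative k' z) (at z)" and c: "continuous_on UNIV (\<lambda>z. k' z (0, 1))"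
  shows "((\<lambda>y. integral torus_cell (\<lambda>x. k (x, y))) has_real_derivative
           integral torus_cell (\<lambda>x. k' (x, y) (0, 1))) (at y)"
proof -
  have "continuous_on UNIV k"
    using d by (meson continuous_at_imp_continuous_on has_derivative_continuous)
  note ck = continuous_on_slice[OF this]
  have dy: "((\<lambda>y. k (x, y)) has_real_derivative k' (x, y) (0, 1)) (at y)" for x y
  proof -
    have "((\<lambda>y. (x, y)) has_derivative (\<lambda>r. (0, r))) (at y)"
      by (auto intro!: derivative_eq_intros)
    from has_derivative_compose[OF this d]
    have "((\<lambda>y. k (x, y)) has_derivative (\<lambda>r. k' (x, y) (0, r))) (at y)" .
    moreover have "(\<lambda>r. k' (x, y) (0, r)) = (*) (k' (x, y) (0, 1))"
    proof
      show "k' (x, y) (0, r) = k' (x, y) (0, 1) * r" for r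
        using linear_scale[OF has_derivative_linear[OF d], of "(x, y)" r "(0, 1)"] by simp
    qed
    ultimately show ?thesis unfolding has_field_derivative_def by simp
  qed
  show ?thesis
    unfolding torus_cell_eq_cbox
  proof (rule leibniz_rule_field_derivative[where U = UNIV])
    show "continuous_on (UNIV \<times> cbox 0 (\<chi> i. 2 * pi)) (\<lambda>(y, x). k' (x, y) (0, 1))"
      unfolding case_prod_unfold
      by (rule continuous_on_compose2[OF c, of _ "\<lambda>p. (snd p, fst p)"]) (auto intro!: continuous_intros)
  qed (auto intro: dy integrable_continuous ck)
qed

lemma slice_integral_horizontal_derivative:
  fixes k :: "(real^'n) \<times> real \<Rightarrow> real"
  assumes d: "\<And>z. (k has_derivative k' z) (at z)" and c: "continuous_on UNIV (\<lambda>z. k' z (axis i 1, 0))"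
    and per: "torus_periodic (\<lambda>x. k (x, y))"
  shows "integral torus_cell (\<lambda>x. k' (x, y) (axis i 1, 0)) = 0"
proof (rule integral_torus_cell_derivative_axis[OF _ per])
  have "continuous_on UNIV k"
    using d by (meson continuous_at_imp_continuous_on has_derivative_continuous)
  then show "continuous_on UNIV (\<lambda>x. k (x, y))" by (rule continuous_on_slice)
  show "continuous_on UNIV (\<lambda>x. k' (x, y) (axis i 1, 0))" by (rule continuous_on_slice[OF c])
  fix x :: "real^'n"
  have "((\<lambda>r. (x + r *\<^sub>R axis i 1, y)) has_derivative (\<lambda>r. (r *\<^sub>R axis i 1, 0))) (at 0)"
    by (auto intro!: derivative_eq_intros)
  from has_derivative_compose[OF this d]
  have "((\<lambda>r. k (x + r *\<^sub>R axis i 1, y)) has_derivative (\<lambda>r. k' (x, y) (r *\<^sub>R axis i 1, 0))) (at 0)"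
    by simp
  moreover have "(\<lambda>r. k' (x, y) (r *\<^sub>R axis i 1, 0)) = (*) (k' (x, y) (axis i 1, 0))"
  proof
    show "k' (x, y) (r *\<^sub>R axis i 1, 0) = k' (x, y) (axis i 1, 0) * r" for r
      using linear_scale[OF has_derivative_linear[OF d], of "(x, y)" r "(axis i 1, 0)"] by simp
  qed
  moreover have "(\<lambda>r. k (x + axis i r, y)) = (\<lambda>r. k (x + r *\<^sub>R axis i 1, y))"
    by (rule ext) (subst axis_eq_scaleR, rule refl)
  ultimately show "((\<lambda>r. k (x + axis i r, y)) has_real_derivative k' (x, y) (axis i 1, 0)) (at 0)"
    unfolding has_field_derivative_def by simp
qed

lemma derivative_translate:
  fixes f :: "(real^'n) \<times> real \<Rightarrow> real"
  assumes per: "\<And>y. torus_periodic (\<lambda>x. f (x, y))"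
    and "(f has_derivative D) (at (x, y))" and d: "(f has_derivative D') (at (x + lattice_vec k, y))"
  shows "D' = D"
proof -
  have "((\<lambda>w. w + (lattice_vec k, 0)) has_derivative (\<lambda>c. c)) (at (x, y))"
    by (auto intro!: derivative_eq_intros)
  from has_derivative_compose[OF this, of f D'] d
  have "((\<lambda>w. f (w + (lattice_vec k, 0))) has_derivative D') (at (x, y))" by simp
  moreover have "f (w + (lattice_vec k, 0)) = f w" for w
    using torus_periodicD[OF per, of "fst w" k "snd w"] by (cases w) simp
  ultimately have "(f has_derivative D') (at (x, y))" by simp
  from has_derivative_unique[OF this assms(2)] show ?thesis .
qed

text \<open>
  The first derivative and the second derivatives are arguments rather than being bound by an
  existential quantifier, as the minimum principle refers to both of them.
\<close>

definition second_derivs_on ::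
  "'a::euclidean_space set \<Rightarrow> ('a \<Rightarrow> real) \<Rightarrow> ('a \<Rightarrow> 'a \<Rightarrow> real) \<Rightarrow> ('a \<Rightarrow> 'a \<Rightarrow> 'a \<Rightarrow> real) \<Rightarrow> bool"
  where
  "second_derivs_on S f D H \<longleftrightarrow>
     (\<forall>z\<in>S. (f has_derivative D z) (at z)) \<and>
     (\<forall>b\<in>Basis. \<forall>z\<in>S. ((\<lambda>w. D w b) has_derivative H z b) (at z)) \<and>
     (\<forall>b\<in>Basis. \<forall>c\<in>Basis. continuous_on S (\<lambda>z. H z b c))"

lemma fluid_domain_subset_closed: "fluid_domain h \<subseteq> closed_fluid_domain h"
  by (auto simp: fluid_domain_def closed_fluid_domain_def)

lemma open_fluid_domain:
  fixes h :: "real^'n \<Rightarrow> real"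
  assumes h: "continuous_on UNIV h"
  shows "open (fluid_domain h)"
  unfolding fluid_domain_def case_prod_unfold
  by (intro open_Collect_less continuous_on_compose2[OF h] continuous_intros) auto

lemma fluid_domain_translate:
  assumes "torus_periodic h"
  shows "(x + lattice_vec k, y) \<in> fluid_domain h \<longleftrightarrow> (x, y) \<in> fluid_domain h"
  using torus_periodicD[OF assms] by (simp add: fluid_domain_def)

text \<open>
  Points on the graph are covered by continuity of $u$ up to the boundary, points strictly above it by
  openness of the exterior.
\<close>

lemma eventually_above_near_exterior:
  fixes h :: "real^'n \<Rightarrow> real" and u :: "(real^'n) \<times> real \<Rightarrow> real"
  assumes h: "continuous_on UNIV h" and u: "continuous_on (closed_fluid_domain h) u"
    and bdry: "\<And>x. c < u (x, h x)" and z: "z \<notin> fluid_domain h"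
  shows "\<forall>\<^sub>F w in nhds z. w \<in> fluid_domain h \<longrightarrow> c < u w"
proof -
  obtain x y where xy: "z = (x, y)" by force
  consider "y > h x" | "y = h x" using z by (force simp: xy fluid_domain_def)
  then show ?thesis
  proof cases
    case 1
    have "open {w. h (fst w) < snd w}"
      by (intro open_Collect_less continuous_on_compose2[OF h] continuous_intros) auto
    from eventually_nhds_in_open[OF this, of z] 1
    show ?thesis by (auto simp: xy fluid_domain_def elim: eventually_mono)
  next
    case 2
    have zc: "z \<in> closed_fluid_domain h" using 2 by (simp add: xy closed_fluid_domain_def)
    have "(u \<longlongrightarrow> u z) (at z within closed_fluid_domain h)"
      using u zc by (simp add: continuous_on_def)
    then have "\<forall>\<^sub>F w in at z within closed_fluid_domain h. c < u w"
      by (rule order_tendstoD(1)) (use bdry[of x] 2 in \<open>simp add: xy\<close>)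
    then have "\<forall>\<^sub>F w in nhds z. w \<noteq> z \<longrightarrow> w \<in> closed_fluid_domain h \<longrightarrow> c < u w"
      by (simp add: eventually_at_filter)
    then show ?thesis
      using z fluid_domain_subset_closed by (auto elim!: eventually_mono)
  qed
qed

text \<open>
  The decay hypothesis concerns only the positive part of the vertical derivative, since $u$ may well
  increase without bound as $y \to -\infty$, as $\varphi - y$ does; what has to be excluded is
  a descent to $-\infty$. It asks for smallness of the slice integrals along a sequence only,
  because monotonicity of the slope of the slice means takes care of the other heights.
\<close>

lemma minimum_principle:
  fixes h :: "real^'n \<Rightarrow> real" and u :: "(real^'n) \<times> real \<Rightarrow> real"
  assumes h: "continuous_on UNIV h" "torus_periodic h"
    and cont: "continuous_on (closed_fluid_domain h) u" and per: "\<And>y. torus_periodic (\<lambda>x. u (x, y))"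
    and der: "second_derivs_on (fluid_domain h) u D H"
    and harm: "\<And>z. z \<in> fluid_domain h \<Longrightarrow> (\<Sum>b\<in>Basis. H z b b) = 0"
    and bdry: "\<And>x. 0 \<le> u (x, h x)"
    and decay: "\<And>c y\<^sub>0. 0 < c \<Longrightarrow> \<exists>y<y\<^sub>0. integral torus_cell (\<lambda>x. (max 0 (D (x, y) (0, 1)))\<^sup>2) < c"
    and z\<^sub>0: "z\<^sub>0 \<in> fluid_domain h"
  shows "0 \<le> u z\<^sub>0"
proof (rule field_le_epsilon)
  fix \<epsilon> :: real assume \<epsilon>: "0 < \<epsilon>"
  define \<Omega> where "\<Omega> = fluid_domain h"
  note op = open_fluid_domain[OF h(1), folded \<Omega>_def]
  have dD: "(u has_derivative D z) (at z)"
    and dH: "b \<in> Basis \<Longrightarrow> ((\<lambda>w. D w b) has_derivative H z b) (at z)" if "z \<in> \<Omega>" for z b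
    using der that by (auto simp: second_derivs_on_def \<Omega>_def)
  have cH: "continuous_on \<Omega> (\<lambda>z. H z b c)" if "b \<in> Basis" "c \<in> Basis" for b c
    using der that by (auto simp: second_derivs_on_def \<Omega>_def)
  have cu: "continuous_on \<Omega> u" 
    using dD by (meson has_derivative_at_withinI has_derivative_continuous_on)
  have cD: "continuous_on \<Omega> (\<lambda>z. D z b)" if "b \<in> Basis" for b
    using dH[OF _ that] by (meson has_derivative_at_withinI has_derivative_continuous_on)
  obtain A A1 A2 where A: "\<And>s. (A has_real_derivative A1 s) (at s)"
      "\<And>s. (A1 has_real_derivative A2 s) (at s)" "continuous_on UNIV A2"
      "\<And>s. -1 \<le> A1 s" "\<And>s. A1 s \<le> 0" "\<And>s. 0 \<le> A2 s" "\<And>s. 0 \<le> A s"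
      "\<And>s. s \<ge> -\<epsilon> \<Longrightarrow> A s = 0" "\<And>s. s \<ge> -\<epsilon> \<Longrightarrow> A1 s = 0" "\<And>s. s \<ge> -\<epsilon> \<Longrightarrow> A2 s = 0"
      "\<And>s. s < -\<epsilon> \<Longrightarrow> A s > 0"
    by (rule smooth_negative_part_exists[where \<epsilon> = \<epsilon>]) (rule that)
  have cA1: "continuous_on UNIV A1"
    using A(2) by (meson DERIV_continuous continuous_at_imp_continuous_on)
  have near: "\<forall>\<^sub>F w in nhds z. w \<in> \<Omega> \<longrightarrow> -\<epsilon> < u w" if "z \<notin> \<Omega>" for z
    unfolding \<Omega>_def
    by (rule eventually_above_near_exterior[OF h(1) cont])
      (use bdry \<epsilon> that in \<open>auto simp: \<Omega>_def intro: less_le_trans[of _ 0]\<close>)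
  \<comment> \<open>\<open>W b\<close> is the derivative of \<open>v\<close> in direction \<open>b\<close>, and \<open>K b c\<close> that of \<open>W b\<close> in direction \<open>c\<close>.\<close>
  define v where "v = (\<lambda>w. if w \<in> \<Omega> then A (u w) else 0)"
  define W where "W = (\<lambda>b w. if w \<in> \<Omega> then A1 (u w) * D w b else 0)"
  define K where "K = (\<lambda>b c z. if z \<in> \<Omega> then A1 (u z) * H z b c + A2 (u z) * D z c * D z b else 0)"
  have dv: "(v has_derivative (\<lambda>c. W c z)) (at z)" for z
  proof -
    have "((\<lambda>w. A (u w)) has_derivative (\<lambda>c. A1 (u z) * D z c)) (at z)" if "z \<in> \<Omega>" for z
      using has_derivative_compose[OF dD[OF that] A(1)[unfolded has_field_derivative_def]] .
    moreover have "\<forall>\<^sub>F w in nhds z. w \<in> \<Omega> \<longrightarrow> A (u w) = 0" if "z \<notin> \<Omega>" for z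
      using near[OF that] by eventually_elim (auto intro: A)
    ultimately show ?thesis
      unfolding v_def W_def by (rule zero_extension_has_derivative[OF op])
  qed
  have dW: "(W b has_derivative (\<lambda>c. K b c z)) (at z)" if b: "b \<in> Basis" for b z
  proof -
    have "((\<lambda>w. A1 (u w) * D w b) has_derivative (\<lambda>c. A1 (u z) * H z b c + A2 (u z) * D z c * D z b)) (at z)"
      if "z \<in> \<Omega>" for z
      using has_derivative_mult[OF has_derivative_compose[OF dD[OF that] A(2)[unfolded has_field_derivative_def]]
          dH[OF that b]] by simp
    moreover have "\<forall>\<^sub>F w in nhds z. w \<in> \<Omega> \<longrightarrow> A1 (u w) * D w b = 0" if "z \<notin> \<Omega>" for z
      using near[OF that] by eventually_elim (auto simp: A)
    ultimately show ?thesis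
      unfolding K_def W_def by (rule zero_extension_has_derivative[OF op])
  qed
  have cv: "continuous_on UNIV v"
    using dv by (meson continuous_at_imp_continuous_on has_derivative_continuous)
  have cW: "continuous_on UNIV (W b)" if "b \<in> Basis" for b
    using dW[OF that] by (meson continuous_at_imp_continuous_on has_derivative_continuous)
  have cK: "continuous_on UNIV (K b b)" if b: "b \<in> Basis" for b
    unfolding K_def
  proof (rule zero_extension_continuous[OF op])
    show "continuous_on \<Omega> (\<lambda>z. A1 (u z) * H z b b + A2 (u z) * D z b * D z b)"
      by (intro continuous_intros cH cD b continuous_on_compose2[OF cA1 cu] continuous_on_compose2[OF A(3) cu]) auto
    show "\<forall>\<^sub>F w in nhds z. w \<in> \<Omega> \<longrightarrow> A1 (u w) * H w b b + A2 (u w) * D w b * D w b = 0" if "z \<notin> \<Omega>" for z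
      using near[OF that] by eventually_elim (auto simp: A)
  qed
  have perv: "torus_periodic (\<lambda>x. v (x, y))" for y
    using fluid_domain_translate[OF h(2)] torus_periodicD[OF per]
    by (auto simp: torus_periodic_def v_def \<Omega>_def)
  have perW: "torus_periodic (\<lambda>x. W b (x, y))" for b y
  proof -
    have "(\<lambda>c. W c (x + lattice_vec k, y)) = (\<lambda>c. W c (x, y))" for x k
      by (rule derivative_translate[OF perv dv dv])
    then have "W b (x + lattice_vec k, y) = W b (x, y)" for x k by (rule fun_cong)
    then show ?thesis by (simp add: torus_periodic_def)
  qed
  define m where "m y = integral torus_cell (\<lambda>x. v (x, y))" for y
  define m1 where "m1 y = integral torus_cell (\<lambda>x. W (0, 1) (x, y))" for y
  define m2 where "m2 y = integral torus_cell (\<lambda>x. K (0, 1) (0, 1) (x, y))" for y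
  have dm: "(m has_real_derivative m1 y) (at y)" for y
    unfolding m_def m1_def by (rule slice_integral_has_derivative[OF dv cW[OF vertical_in_Basis]])
  have dm1: "(m1 has_real_derivative m2 y) (at y)" for y
    unfolding m2_def m1_def
    by (rule slice_integral_has_derivative[OF dW[OF vertical_in_Basis] cK[OF vertical_in_Basis]])
  have int: "(\<lambda>x. k (x, y)) integrable_on torus_cell" if "continuous_on UNIV k"
    for k :: "(real^'n) \<times> real \<Rightarrow> real" and y
    unfolding torus_cell_eq_cbox by (intro integrable_continuous continuous_on_slice that)
  \<comment> \<open>The Laplacian of \<open>v\<close> is nonnegative, and its horizontal part has integral zero over a slice.\<close>
  have m2_nonneg: "0 \<le> m2 y" for y
  proof -
    have "0 \<le> integral torus_cell (\<lambda>x. \<Sum>b\<in>Basis. K b b (x, y))"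
    proof (rule integral_nonneg)
      show "(\<lambda>x. \<Sum>b\<in>Basis. K b b (x, y)) integrable_on torus_cell"
        by (intro integrable_sum int cK) auto
      show "0 \<le> (\<Sum>b\<in>Basis. K b b (x, y))" for x
      proof (cases "(x, y) \<in> \<Omega>")
        case True
        have "(\<Sum>b\<in>Basis. K b b (x, y)) = A1 (u (x, y)) * (\<Sum>b\<in>Basis. H (x, y) b b)
            + (\<Sum>b\<in>Basis. A2 (u (x, y)) * (D (x, y) b * D (x, y) b))"
          using True by (simp add: K_def sum.distrib sum_distrib_left mult.assoc)
        also have "(\<Sum>b\<in>Basis. H (x, y) b b) = 0" using harm True by (simp add: \<Omega>_def)
        finally show ?thesis by (simp add: sum_nonneg A(6))
      qed (simp add: K_def)
    qed
    also have "\<dots> = (\<Sum>b\<in>Basis. integral torus_cell (\<lambda>x. K b b (x, y)))"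
      by (intro integral_sum int cK) auto
    also have "\<dots> = (\<Sum>i\<in>UNIV. integral torus_cell (\<lambda>x. K (axis i 1, 0) (axis i 1, 0) (x, y))) + m2 y"
      unfolding m2_def by (rule sum_Basis_slab)
    also have "(\<Sum>i\<in>UNIV. integral torus_cell (\<lambda>x. K (axis i 1, 0) (axis i 1, 0) (x, y))) = 0"
      by (intro sum.neutral ballI slice_integral_horizontal_derivative[OF dW cK perW] horizontal_in_Basis)
    finally show ?thesis by simp
  qed
  have mono: "m1 y \<le> m1 y'" if "y \<le> y'" for y y'
    by (rule DERIV_nonneg_imp_nondecreasing[OF that]) (use dm1 m2_nonneg in blast)
  obtain xlo xhi where bounds: "\<And>x. h xlo \<le> h x" "\<And>x. h x \<le> h xhi"
    using torus_periodic_attains_bounds[OF h] by metis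
  have above: "m y = 0 \<and> m1 y = 0" if "y \<ge> h xhi" for y
  proof -
    have "(x, y) \<notin> \<Omega>" for x using that bounds(2)[of x] by (simp add: \<Omega>_def fluid_domain_def)
    then show ?thesis by (simp add: m_def m1_def v_def W_def)
  qed
  have m1_le: "m1 y \<le> 0" for y
    using mono[of y "max y (h xhi)"] above[of "max y (h xhi)"] by simp
  have m1_zero: "m1 y = 0" for y
  proof (rule ccontr)
    assume "m1 y \<noteq> 0"
    define a where "a = - m1 y"
    have a: "a > 0" using \<open>m1 y \<noteq> 0\<close> m1_le[of y] by (simp add: a_def)
    define V where "V = measure lborel (torus_cell :: (real^'n) set)"
    \<comment> \<open>The slope would stay below \<open>-a\<close> further down. By \<open>p \<le> l + p\<^sup>2 / (4 * l)\<close> with this \<open>l\<close>, it is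
      at least \<open>-3 * a / 4\<close> at any height where the energy of the slice is below \<open>a * l\<close>.\<close>
    define l where "l = a / (2 * (V + 1))"
    have V: "V \<ge> 0" by (simp add: V_def)
    then have l: "l > 0" using a by (simp add: l_def)
    have lV: "l * V \<le> a / 2" using V a by (simp add: l_def field_simps)
    obtain y' where y': "y' < min y (h xlo)"
        "integral torus_cell (\<lambda>x. (max 0 (D (x, y') (0, 1)))\<^sup>2) < a * l"
      using decay[of "a * l" "min y (h xlo)"] a l by auto
    have in\<Omega>: "(x, y') \<in> \<Omega>" for x using y'(1) bounds(1)[of x] by (simp add: \<Omega>_def fluid_domain_def)
    have "continuous_on UNIV (\<lambda>x. D (x, y') (0, 1))"
      by (rule continuous_on_compose2[OF cD[OF vertical_in_Basis]]) (auto intro!: continuous_intros in\<Omega>)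
    then have cp: "continuous_on S (\<lambda>x. max 0 (D (x, y') (0, 1)))" for S
      by (intro continuous_intros) (auto intro: continuous_on_subset)
    have "a \<le> - m1 y'" using mono[of y' y] y'(1) by (simp add: a_def)
    also have "- m1 y' = integral torus_cell (\<lambda>x. - W (0, 1) (x, y'))" by (simp add: m1_def)
    also have "\<dots> \<le> integral torus_cell (\<lambda>x. l + (1 / (4 * l)) * (max 0 (D (x, y') (0, 1)))\<^sup>2)"
    proof (rule integral_le)
      show "(\<lambda>x. - W (0, 1) (x, y')) integrable_on torus_cell"
        using int[OF cW[OF vertical_in_Basis]] by (rule integrable_neg)
      show "(\<lambda>x. l + (1 / (4 * l)) * (max 0 (D (x, y') (0, 1)))\<^sup>2) integrable_on torus_cell"
        unfolding torus_cell_eq_cbox by (intro integrable_continuous continuous_intros cp)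
      fix x
      define p where "p = max 0 (D (x, y') (0, 1))"
      have "- W (0, 1) (x, y') = (- A1 (u (x, y'))) * D (x, y') (0, 1)" using in\<Omega> by (simp add: W_def)
      also have "\<dots> \<le> (- A1 (u (x, y'))) * p" using A(5) by (intro mult_left_mono) (auto simp: p_def)
      also have "\<dots> \<le> 1 * p" using A(4)[of "u (x, y')"] by (intro mult_right_mono) (auto simp: p_def)
      also have "1 * p \<le> l + (1 / (4 * l)) * p\<^sup>2"
      proof -
        have "0 \<le> (p - 2 * l)\<^sup>2 / (4 * l)" using l by simp
        also have "\<dots> = l + (1 / (4 * l)) * p\<^sup>2 - p" using l by (simp add: field_simps power2_eq_square)
        finally show ?thesis by simp
      qed
      finally show "- W (0, 1) (x, y') \<le> l + (1 / (4 * l)) * (max 0 (D (x, y') (0, 1)))\<^sup>2"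
        by (simp add: p_def)
    qed
    also have "\<dots> = l * V + (1 / (4 * l)) * integral torus_cell (\<lambda>x. (max 0 (D (x, y') (0, 1)))\<^sup>2)"
      unfolding torus_cell_eq_cbox V_def
      using l by (subst integral_add) (auto intro!: integrable_continuous continuous_intros cp)
    also have "\<dots> < a / 2 + (1 / (4 * l)) * (a * l)"
      using lV y'(2) l by (intro add_le_less_mono mult_strict_left_mono) auto
    also have "\<dots> = a * (3 / 4)" using l by (simp add: field_simps)
    finally show False using a by simp
  qed
  have m_zero: "m y = 0" for y
  proof -
    have "m y = m (h xhi)" using DERIV_isconst_all[of m y "h xhi"] dm by (simp add: m1_zero)
    then show ?thesis using above by simp
  qed
  show "0 \<le> u z\<^sub>0 + \<epsilon>"
  proof (rule ccontr)
    assume neg: "\<not> 0 \<le> u z\<^sub>0 + \<epsilon>"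
    obtain x y where xy: "z\<^sub>0 = (x, y)" by force
    obtain k where k: "x + lattice_vec k \<in> torus_cell" using torus_cell_representative by blast
    have "box (0 :: real^'n) (\<chi> i. 2 * pi) \<noteq> {}" 
      by (auto simp: box_ne_empty inner_axis Basis_vec_def)
    moreover have "integral (cbox 0 (\<chi> i. 2 * pi)) (\<lambda>x. v (x, y)) = 0"
      using m_zero[of y] by (simp add: m_def torus_cell_eq_cbox)
    ultimately have "v (x + lattice_vec k, y) = 0"
      using has_integral_0_cbox_imp_0[of 0 "\<chi> i. 2 * pi" "\<lambda>x. v (x, y)" "x + lattice_vec k"]
        k continuous_on_slice[OF cv] int[OF cv, of y] A(7)
      by (auto simp: torus_cell_eq_cbox v_def has_integral_iff)
    then have "v z\<^sub>0 = 0" using torus_periodicD[OF perv] by (simp add: xy)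
    moreover have "v z\<^sub>0 > 0" using neg z\<^sub>0 A(11)[of "u z\<^sub>0"] by (simp add: v_def \<Omega>_def)
    ultimately show False by simp
  qed
qed

section \<open>Comparison of Dirichlet to Neumann operators at a contact point\<close>

lemma partial_deriv_eq:
  assumes "(f has_derivative f') (at z)"
  shows "partial_deriv b f z = f' b"
proof -
  have "((\<lambda>r. z + r *\<^sub>R b) has_derivative (\<lambda>r. r *\<^sub>R b)) (at 0)"
    by (auto intro!: derivative_eq_intros)
  from has_derivative_compose[OF this, of f f'] assms
  have "((\<lambda>r. f (z + r *\<^sub>R b)) has_derivative (\<lambda>r. f' (r *\<^sub>R b))) (at 0)" by simp
  moreover have "(\<lambda>r. f' (r *\<^sub>R b)) = (*) (f' b)"
  proof
    show "f' (r *\<^sub>R b) = f' b * r" for r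
      using linear_scale[OF has_derivative_linear[OF assms], of r b] by simp
  qed
  ultimately have "((\<lambda>r. f (z + r *\<^sub>R b)) has_field_derivative f' b) (at 0)"
    unfolding has_field_derivative_def by simp
  then show ?thesis unfolding partial_deriv_def by (rule DERIV_imp_deriv)
qed

lemma Ck_on_2_imp_second_derivs_on:
  assumes "open S" "Ck_on 2 S f"
  obtains D H where "second_derivs_on S f D H"
proof -
  obtain D where D: "\<And>z. z \<in> S \<Longrightarrow> (f has_derivative D z) (at z within S)"
    and C1: "\<And>b. b \<in> Basis \<Longrightarrow> Ck_on (Suc 0) S (\<lambda>z. D z b)"
    using assms(2) unfolding numeral_2_eq_2 by (simp only: Ck_on.simps(2)) blast
  have "\<forall>b\<in>Basis. \<exists>H. (\<forall>z\<in>S. ((\<lambda>z. D z b) has_derivative H z) (at z within S)) \<and>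
      (\<forall>c\<in>Basis. continuous_on S (\<lambda>z. H z c))"
    using C1 by simp
  then obtain H where H: "\<And>b z. b \<in> Basis \<Longrightarrow> z \<in> S \<Longrightarrow> ((\<lambda>z. D z b) has_derivative H b z) (at z within S)"
      "\<And>b c. b \<in> Basis \<Longrightarrow> c \<in> Basis \<Longrightarrow> continuous_on S (\<lambda>z. H b z c)"
    unfolding bchoice_iff by blast
  have "second_derivs_on S f D (\<lambda>z b. H b z)"
    using D H at_within_open[OF _ assms(1)] by (auto simp: second_derivs_on_def)
  then show thesis by (rule that)
qed

lemma laplacian_eq_sum_second_derivs:
  assumes S: "open S" and d: "second_derivs_on S f D H" and z: "z \<in> S"
  shows "laplacian f z = (\<Sum>b\<in>Basis. H z b b)"
  unfolding laplacian_def
proof (rule sum.cong[OF refl])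
  fix b :: 'a assume b: "b \<in> Basis"
  have "((\<lambda>w. D w b) has_derivative H z b) (at z)" using d z b by (auto simp: second_derivs_on_def)
  moreover have "D w b = partial_deriv b f w" if "w \<in> S" for w
    using d that by (auto simp: second_derivs_on_def intro: partial_deriv_eq[symmetric])
  ultimately have "(partial_deriv b f has_derivative H z b) (at z)"
    using has_derivative_transform_within_open[OF _ S z] by blast
  then show "partial_deriv b (partial_deriv b f) z = H z b b" by (rule partial_deriv_eq)
qed

lemma derivative_le_norm_gradient:
  assumes "(f has_derivative f') (at z)" "b \<in> Basis"
  shows "(f' b)\<^sup>2 \<le> (norm (gradient f z))\<^sup>2"
proof -
  have "gradient f z \<bullet> b = f' b"
    using assms by (simp add: gradient_def partial_deriv_eq[OF assms(1)] inner_sum_left_Basis)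
  then show ?thesis using Basis_le_norm[OF assms(2), of "gradient f z"] by (simp add: abs_le_square_iff[symmetric])
qed

lemma second_derivs_on_diff:
  assumes "second_derivs_on S f D H" "second_derivs_on T g E K" "U \<subseteq> S" "U \<subseteq> T"
  shows "second_derivs_on U (\<lambda>z. f z - g z) (\<lambda>z c. D z c - E z c) (\<lambda>z b c. H z b c - K z b c)"
  using assms unfolding second_derivs_on_def
  by (auto intro!: has_derivative_diff continuous_on_diff) (meson continuous_on_subset)+

lemma second_derivs_on_shift:
  assumes d: "second_derivs_on S f D H"
  shows "second_derivs_on {z. z + v \<in> S} (\<lambda>z. f (z + v) + M) (\<lambda>z. D (z + v)) (\<lambda>z. H (z + v))"
proof -
  have sh: "((\<lambda>z. z + v) has_derivative (\<lambda>c. c)) (at z)" for z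
    by (auto intro!: derivative_eq_intros)
  show ?thesis
    unfolding second_derivs_on_def
  proof (intro conjI ballI)
    fix z assume "z \<in> {z. z + v \<in> S}"
    then have "(f has_derivative D (z + v)) (at (z + v))" using d by (auto simp: second_derivs_on_def)
    from has_derivative_add[OF has_derivative_compose[OF sh this] has_derivative_const[of M]]
    show "((\<lambda>z. f (z + v) + M) has_derivative D (z + v)) (at z)" by simp
  next
    fix b :: 'a and z assume "b \<in> Basis" "z \<in> {z. z + v \<in> S}"
    then have "((\<lambda>w. D w b) has_derivative H (z + v) b) (at (z + v))" using d by (auto simp: second_derivs_on_def)
    from has_derivative_compose[OF sh this]
    show "((\<lambda>z. D (z + v) b) has_derivative H (z + v) b) (at z)" .
  next
    fix b c :: 'a assume "b \<in> Basis" "c \<in> Basis"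
    then have "continuous_on S (\<lambda>z. H z b c)" using d by (auto simp: second_derivs_on_def)
    then show "continuous_on {z. z + v \<in> S} (\<lambda>z. H (z + v) b c)"
      by (rule continuous_on_compose2) (auto intro!: continuous_intros)
  qed
qed

lemma second_derivs_on_continuous:
  assumes "second_derivs_on S f D H" "b \<in> Basis"
  shows "continuous_on S (\<lambda>z. D z b)"
  using assms unfolding second_derivs_on_def
  by (meson has_derivative_at_withinI has_derivative_continuous_on)

text \<open>
  The part of the Dirichlet energy that bounds the slope of the slice means.
\<close>

definition slice_energy :: "((real^'n) \<times> real \<Rightarrow> (real^'n) \<times> real \<Rightarrow> real) \<Rightarrow> real \<Rightarrow> real" where
  "slice_energy D y = integral torus_cell (\<lambda>x. (D (x, y) (0, 1))\<^sup>2)"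

text \<open>
  What is kept of a variational solution. The energy condition is expressed by integrals over
  full horizontal slices, whose invariance under horizontal translations is that of the integral of
  a continuous periodic function. The bound does not depend on the height \<open>y\<^sub>0\<close>, so that two such
  functions can be considered below a common height.
\<close>

definition finite_energy_harmonic :: "(real^'n \<Rightarrow> real) \<Rightarrow> ((real^'n) \<times> real \<Rightarrow> real) \<Rightarrow> bool" where
  "finite_energy_harmonic h \<phi> \<longleftrightarrow>
     continuous_on UNIV h \<and> torus_periodic h \<and>
     continuous_on (closed_fluid_domain h) \<phi> \<and> (\<forall>y. torus_periodic (\<lambda>x. \<phi> (x, y))) \<and>
     (\<exists>D H B. second_derivs_on (fluid_domain h) \<phi> D H \<and>
        (\<forall>z\<in>fluid_domain h. (\<Sum>b\<in>Basis. H z b b) = 0) \<and>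
        (\<forall>y\<^sub>0. (\<forall>x. y\<^sub>0 < h x) \<longrightarrow> (\<forall>N\<ge>0. integral {y\<^sub>0 - N..y\<^sub>0} (slice_energy D) \<le> B)))"

lemma slice_energy_continuous:
  fixes h :: "real^'n \<Rightarrow> real"
  assumes d: "second_derivs_on (fluid_domain h) \<phi> D H" and y0: "\<And>x. y\<^sub>0 < h x"
  shows "continuous_on {..y\<^sub>0} (slice_energy D)"
proof -
  have "continuous_on ({..y\<^sub>0} \<times> cbox 0 (\<chi> i. 2 * pi)) (\<lambda>p. D (snd p, fst p) (0, 1))"
    by (rule continuous_on_compose2[OF second_derivs_on_continuous[OF d vertical_in_Basis], of _ "\<lambda>p. (snd p, fst p)"])
      (auto simp: fluid_domain_def intro!: continuous_intros intro: le_less_trans[OF _ y0])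
  then show ?thesis
    unfolding slice_energy_def[abs_def] torus_cell_eq_cbox
    by (intro integral_continuous_on_param) (auto simp: case_prod_unfold intro!: continuous_intros)
qed

lemma slice_energy_nonneg: "0 \<le> slice_energy D y"
  unfolding slice_energy_def by (cases "(\<lambda>x. (D (x, y) (0, 1))\<^sup>2) integrable_on torus_cell")
    (auto intro: integral_nonneg simp: not_integrable_integral)

lemma harmonic_extension_imp_finite_energy_harmonic:
  fixes h :: "real^'n \<Rightarrow> real"
  assumes h: "continuous_on UNIV h" "torus_periodic h" and \<phi>: "harmonic_extension h \<psi> \<phi>"
  shows "finite_energy_harmonic h \<phi>"
proof -
  note op = open_fluid_domain[OF h(1)]
  obtain D H where d: "second_derivs_on (fluid_domain h) \<phi> D H"
    using Ck_on_2_imp_second_derivs_on[OF op] \<phi> unfolding harmonic_extension_def by metis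
  have lap: "\<forall>z\<in>fluid_domain h. (\<Sum>b\<in>Basis. H z b b) = 0"
    using laplacian_eq_sum_second_derivs[OF op d] \<phi> unfolding harmonic_extension_def by simp
  define g where "g = (\<lambda>z. (norm (gradient \<phi> z))\<^sup>2)"
  define S where "S = fluid_domain h \<inter> torus_cell \<times> UNIV"
  have gS: "set_integrable lebesgue S g" using \<phi> by (simp add: harmonic_extension_def g_def S_def)
  have "integral {y\<^sub>0 - N..y\<^sub>0} (slice_energy D) \<le> integral S g" if y0: "\<And>x. y\<^sub>0 < h x" and "N \<ge> 0" for y\<^sub>0 N
  proof -
    define R :: "((real^'n) \<times> real) set" where "R = cbox (0, y\<^sub>0 - N) (\<chi> i. 2 * pi, y\<^sub>0)"
    define k where "k z = (D z (0, 1))\<^sup>2" for z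
    have RS: "R \<subseteq> S" using y0 
      by (auto simp: R_def S_def cbox_Pair_eq torus_cell_eq_cbox fluid_domain_def intro: le_less_trans)
    have gR: "g integrable_on R"
      by (rule set_lebesgue_integral_eq_integral[OF set_integrable_subset[OF gS _ RS]]) (simp add: R_def)
    have ck: "continuous_on R k" unfolding k_def
      by (intro continuous_intros continuous_on_subset[OF second_derivs_on_continuous[OF d vertical_in_Basis]])
        (use RS in \<open>auto simp: S_def\<close>)
    have ck': "continuous_on (cbox (0, y\<^sub>0 - N) (\<chi> i. 2 * pi, y\<^sub>0)) (\<lambda>(x, y). k (x, y))"
      using ck by (simp add: R_def)
    have "integral {y\<^sub>0 - N..y\<^sub>0} (slice_energy D) = integral (cbox (y\<^sub>0 - N) y\<^sub>0) (\<lambda>y. integral torus_cell (\<lambda>x. k (x, y)))"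
      by (simp add: slice_energy_def[abs_def] k_def)
    also have "\<dots> = integral torus_cell (\<lambda>x. integral (cbox (y\<^sub>0 - N) y\<^sub>0) (\<lambda>y. k (x, y)))"
      unfolding torus_cell_eq_cbox using integral_swap_continuous[OF ck'] by simp
    also have "\<dots> = integral R k"
      unfolding torus_cell_eq_cbox R_def
      using integral_prod_continuous[of 0 "y\<^sub>0 - N" "\<chi> i. 2 * pi" y\<^sub>0 k] ck by (simp add: R_def)
    also have "\<dots> \<le> integral R g"
    proof (rule integral_le[OF _ gR])
      show "k integrable_on R" using ck unfolding R_def by (rule integrable_continuous)
      show "k z \<le> g z" if "z \<in> R" for z
        unfolding k_def g_def using that RS d
        by (intro derivative_le_norm_gradient vertical_in_Basis) (auto simp: S_def second_derivs_on_def)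
    qed
    also have "\<dots> \<le> integral S g"
      by (rule integral_subset_le[OF RS gR set_lebesgue_integral_eq_integral(1)[OF gS]]) (simp add: g_def)
    finally show ?thesis .
  qed
  then show ?thesis
    using h \<phi> d lap unfolding finite_energy_harmonic_def harmonic_extension_def by blast
qed

text \<open>
  If \<open>h\<close> solves the equation, so do its horizontal and vertical translates: moving the domain by \<open>M\<close>
  upwards and adding \<open>M\<close> to the function turns the extension of \<open>h\<close> into the extension of \<open>h + M\<close>.
\<close>

lemma finite_energy_harmonic_shift:
  fixes h :: "real^'n \<Rightarrow> real"
  assumes "finite_energy_harmonic h \<phi>"
  shows "finite_energy_harmonic (\<lambda>x. h (x + v) + M) (\<lambda>z. \<phi> (z + (v, -M)) + M)"
proof -
  obtain D H B where h: "continuous_on UNIV h" "torus_periodic h"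
    and c: "continuous_on (closed_fluid_domain h) \<phi>" and per: "\<And>y. torus_periodic (\<lambda>x. \<phi> (x, y))"
    and d: "second_derivs_on (fluid_domain h) \<phi> D H"
    and lap: "\<And>z. z \<in> fluid_domain h \<Longrightarrow> (\<Sum>b\<in>Basis. H z b b) = 0"
    and en: "\<And>y\<^sub>0 N. (\<And>x. y\<^sub>0 < h x) \<Longrightarrow> N \<ge> 0 \<Longrightarrow> integral {y\<^sub>0 - N..y\<^sub>0} (slice_energy D) \<le> B"
    using assms unfolding finite_energy_harmonic_def by blast
  let ?h = "\<lambda>x. h (x + v) + M"
  have dom: "fluid_domain ?h = {z. z + (v, -M) \<in> fluid_domain h}"
    "closed_fluid_domain ?h = {z. z + (v, -M) \<in> closed_fluid_domain h}"
    by (auto simp: fluid_domain_def closed_fluid_domain_def)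
  have E: "slice_energy (\<lambda>z. D (z + (v, -M))) y = slice_energy D (y - M)" if y: "\<And>x. y < ?h x" for y
  proof -
    have in\<Omega>: "(x, y - M) \<in> fluid_domain h" for x using y[of "x - v"] by (simp add: fluid_domain_def)
    have "continuous_on UNIV (\<lambda>x. D (x, y - M) (0, 1))"
      by (rule continuous_on_compose2[OF second_derivs_on_continuous[OF d vertical_in_Basis]])
        (auto intro!: continuous_intros in\<Omega>)
    moreover have "torus_periodic (\<lambda>x. (D (x, y - M) (0, 1))\<^sup>2)"
    proof -
      have "(\<phi> has_derivative D (x, y - M)) (at (x, y - M))" for x
        using d in\<Omega> by (auto simp: second_derivs_on_def)
      then have "D (x + lattice_vec k, y - M) = D (x, y - M)" for x k
        using derivative_translate[of \<phi>] per by blast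
      then show ?thesis by (simp add: torus_periodic_def)
    qed
    ultimately have "integral torus_cell (\<lambda>x. (D (x + v, y - M) (0, 1))\<^sup>2) =
        integral torus_cell (\<lambda>x. (D (x, y - M) (0, 1))\<^sup>2)"
      by (intro integral_torus_cell_shift[of "\<lambda>x. (D (x, y - M) (0, 1))\<^sup>2"] continuous_intros)
    then show ?thesis by (simp add: slice_energy_def)
  qed
  have "integral {y\<^sub>0 - N..y\<^sub>0} (slice_energy (\<lambda>z. D (z + (v, -M)))) \<le> B"
    if y0: "\<And>x. y\<^sub>0 < ?h x" and N: "N \<ge> 0" for y\<^sub>0 N
  proof -
    have y0': "y\<^sub>0 - M < h x" for x using y0[of "x - v"] by simp
    have "integral {y\<^sub>0 - N..y\<^sub>0} (slice_energy (\<lambda>z. D (z + (v, -M)))) =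
        integral {y\<^sub>0 - N..y\<^sub>0} (\<lambda>y. slice_energy D (y - M))"
      by (intro integral_cong E) (auto intro: le_less_trans[OF _ y0])
    also have "\<dots> = integral {y\<^sub>0 - M - N..y\<^sub>0 - M} (slice_energy D)"
      using integral_shift_real_ivl[of "y\<^sub>0 - M - N" "-M" "y\<^sub>0 - M" "slice_energy D"] by (simp add: algebra_simps)
    also have "\<dots> \<le> B" by (rule en[OF y0' N])
    finally show ?thesis .
  qed
  moreover have "continuous_on (closed_fluid_domain ?h) (\<lambda>z. \<phi> (z + (v, -M)) + M)"
    unfolding dom by (intro continuous_intros continuous_on_compose2[OF c]) auto
  moreover have "continuous_on UNIV ?h" 
    by (intro continuous_intros continuous_on_compose2[OF h(1)]) auto
  moreover have "torus_periodic ?h" "\<And>y. torus_periodic (\<lambda>x. \<phi> ((x, y) + (v, -M)) + M)"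
    using torus_periodic_shift[OF h(2), of v] torus_periodic_shift[OF per, of v] 
    by (auto simp: torus_periodic_def)
  moreover have "second_derivs_on (fluid_domain ?h) (\<lambda>z. \<phi> (z + (v, -M)) + M) (\<lambda>z. D (z + (v, -M))) (\<lambda>z. H (z + (v, -M)))"
    unfolding dom by (rule second_derivs_on_shift[OF d])
  moreover have "\<forall>z\<in>fluid_domain ?h. (\<Sum>b\<in>Basis. H (z + (v, -M)) b b) = 0"
    using lap unfolding dom by blast
  ultimately show ?thesis
    unfolding finite_energy_harmonic_def by blast
qed

lemma bounded_energy_imp_small_slice:
  fixes J :: "real \<Rightarrow> real"
  assumes cont: "continuous_on {..y\<^sub>0} J" and nonneg: "\<And>y. 0 \<le> J y"
    and bound: "\<And>N. 0 \<le> N \<Longrightarrow> integral {y\<^sub>0 - N..y\<^sub>0} J \<le> B" and c: "0 < c"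
  obtains y where "y < y\<^sub>1" "y \<le> y\<^sub>0" "J y < c"
proof (rule ccontr)
  assume no: "\<not> thesis"
  note witness = that
  \<comment> \<open>Otherwise \<open>J \<ge> c\<close> below height \<open>y2\<close>, and the integral over a slab reaching far enough down exceeds \<open>B\<close>.\<close>
  define y2 where "y2 = min y\<^sub>0 y\<^sub>1 - 1"
  have ge: "c \<le> J y" if "y \<le> y2" for y
    using no witness[of y] that by (force simp: y2_def not_less[symmetric])
  define N where "N = y\<^sub>0 - y2 + (\<bar>B\<bar> + 1) / c"
  have y2: "y2 \<le> y\<^sub>0" by (simp add: y2_def)
  have N: "N \<ge> 0" "y\<^sub>0 - N \<le> y2" using y2 c by (auto simp: N_def)
  have int: "J integrable_on {a..b}" if "b \<le> y\<^sub>0" for a b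
    by (rule integrable_continuous_real[OF continuous_on_subset[OF cont]]) (use that in auto)
  have "\<bar>B\<bar> + 1 = c * (y2 - (y\<^sub>0 - N))" using c by (simp add: N_def)
  also have "\<dots> = integral {y\<^sub>0 - N..y2} (\<lambda>_. c)" using N by simp
  also have "\<dots> \<le> integral {y\<^sub>0 - N..y2} J"
    by (rule integral_le) (use int[OF y2] ge in auto)
  also have "\<dots> \<le> integral {y\<^sub>0 - N..y\<^sub>0} J"
    by (rule integral_subset_le) (use y2 int nonneg in auto)
  also have "\<dots> \<le> B" by (rule bound[OF N(1)])
  finally show False by simp
qed

lemma finite_energy_harmonicE:
  assumes "finite_energy_harmonic h \<phi>"
  obtains D H B where "continuous_on UNIV h" "torus_periodic h"
    "continuous_on (closed_fluid_domain h) \<phi>" "\<And>y. torus_periodic (\<lambda>x. \<phi> (x, y))"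
    "second_derivs_on (fluid_domain h) \<phi> D H"
    "\<forall>z\<in>fluid_domain h. (\<Sum>b\<in>Basis. H z b b) = 0"
    "\<forall>y\<^sub>0. (\<forall>x. y\<^sub>0 < h x) \<longrightarrow> (\<forall>N\<ge>0. integral {y\<^sub>0 - N..y\<^sub>0} (slice_energy D) \<le> B)"
  using assms unfolding finite_energy_harmonic_def by blast

lemma positive_part_slice_le:
  fixes h :: "real^'n \<Rightarrow> real"
  assumes "second_derivs_on (fluid_domain h) u D H" "\<And>x. y < h x"
    and "q integrable_on torus_cell" "\<And>x. (max 0 (D (x, y) (0, 1)))\<^sup>2 \<le> q x"
  shows "integral torus_cell (\<lambda>x. (max 0 (D (x, y) (0, 1)))\<^sup>2) \<le> integral torus_cell q"
proof (rule integral_le)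
  have "continuous_on UNIV (\<lambda>x. D (x, y) (0, 1))"
    by (rule continuous_on_compose2[OF second_derivs_on_continuous[OF assms(1) vertical_in_Basis]])
      (auto simp: fluid_domain_def assms(2) intro!: continuous_intros)
  then show "(\<lambda>x. (max 0 (D (x, y) (0, 1)))\<^sup>2) integrable_on torus_cell"
    unfolding torus_cell_eq_cbox
    by (intro integrable_continuous continuous_intros) (auto intro: continuous_on_subset)
qed (use assms in auto)

lemma vertical_derivative_slice_integrable:
  fixes h :: "real^'n \<Rightarrow> real"
  assumes "second_derivs_on (fluid_domain h) u D H" "\<And>x. y < h x"
  shows "(\<lambda>x. (D (x, y) (0, 1))\<^sup>2) integrable_on torus_cell"
proof -
  have "continuous_on UNIV (\<lambda>x. D (x, y) (0, 1))"
    by (rule continuous_on_compose2[OF second_derivs_on_continuous[OF assms(1) vertical_in_Basis]])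
      (auto simp: fluid_domain_def assms(2) intro!: continuous_intros)
  then show ?thesis
    unfolding torus_cell_eq_cbox
    by (intro integrable_continuous continuous_intros) (auto intro: continuous_on_subset)
qed

lemma torus_periodic_strict_lower_bound:
  fixes h :: "real^'n \<Rightarrow> real"
  assumes "continuous_on UNIV h" "torus_periodic h"
  obtains y where "\<And>x. y < h x"
proof -
  obtain x0 where "\<And>x. h x0 \<le> h x" using torus_periodic_attains_bounds[OF assms] by metis
  then have "h x0 - 1 < h x" for x by (smt (verit))
  then show thesis by (rule that)
qed

text \<open>
  Minimum principle for the pressure $\varphi - y$, which vanishes on the free surface. Subtracting
  $y$ decreases the vertical derivative, hence does not increase the square of its positive part.
\<close>

lemma height_le_harmonic_extension:
  fixes h :: "real^'n \<Rightarrow> real"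
  assumes \<phi>: "finite_energy_harmonic h \<phi>" and tr: "\<And>x. \<phi> (x, h x) = h x" and xy: "y \<le> h x"
  shows "y \<le> \<phi> (x, y)"
proof (cases "y = h x")
  case False
  obtain D H B where h: "continuous_on UNIV h" "torus_periodic h"
    and c: "continuous_on (closed_fluid_domain h) \<phi>" and per: "\<And>y. torus_periodic (\<lambda>x. \<phi> (x, y))"
    and d: "second_derivs_on (fluid_domain h) \<phi> D H"
    and lap: "\<forall>z\<in>fluid_domain h. (\<Sum>b\<in>Basis. H z b b) = 0"
    and en: "\<forall>y\<^sub>0. (\<forall>x. y\<^sub>0 < h x) \<longrightarrow> (\<forall>N\<ge>0. integral {y\<^sub>0 - N..y\<^sub>0} (slice_energy D) \<le> B)"
    by (rule finite_energy_harmonicE[OF \<phi>]) (rule that)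
  note lap = lap[rule_format] and en = en[rule_format]
  obtain y0 where y0: "\<And>x. y0 < h x" using torus_periodic_strict_lower_bound[OF h] by blast
  have "second_derivs_on UNIV (snd :: (real^'n) \<times> real \<Rightarrow> real) (\<lambda>z. snd) (\<lambda>z b c. 0)"
    by (auto simp: second_derivs_on_def intro!: derivative_eq_intros)
  from second_derivs_on_diff[OF d this order_refl subset_UNIV]
  have d': "second_derivs_on (fluid_domain h) (\<lambda>z. \<phi> z - snd z) (\<lambda>z c. D z c - snd c) (\<lambda>z b c. H z b c)"
    by simp
  have "0 \<le> \<phi> (x, y) - snd (x, y)"
  proof (rule minimum_principle[OF h _ _ d' lap])
    show "continuous_on (closed_fluid_domain h) (\<lambda>z. \<phi> z - snd z)" by (intro continuous_intros c)
    show "torus_periodic (\<lambda>x. \<phi> (x, y) - snd (x, y))" for y using per by (simp add: torus_periodic_def)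
    show "0 \<le> \<phi> (x, h x) - snd (x, h x)" for x by (simp add: tr)
    show "(x, y) \<in> fluid_domain h" using False xy by (simp add: fluid_domain_def)
    fix c y\<^sub>1 :: real assume c: "0 < c"
    obtain y where y: "y < y\<^sub>1" "y \<le> y0" "slice_energy D y < c"
      by (rule bounded_energy_imp_small_slice[OF slice_energy_continuous[OF d y0] slice_energy_nonneg en[OF y0] c])
    have yh: "y < h x" for x using y(2) y0[of x] by simp
    have "integral torus_cell (\<lambda>x. (max 0 (D (x, y) (0, 1) - snd (0 :: real^'n, 1 :: real)))\<^sup>2) \<le> slice_energy D y"
      unfolding slice_energy_def
    proof (rule positive_part_slice_le[OF d' yh vertical_derivative_slice_integrable[OF d yh]])
      show "(max 0 (D (x, y) (0, 1) - snd (0 :: real^'n, 1 :: real)))\<^sup>2 \<le> (D (x, y) (0, 1))\<^sup>2" for x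
        by (simp add: abs_le_square_iff[symmetric])
    qed
    then show "\<exists>y<y\<^sub>1. integral torus_cell (\<lambda>x. (max 0 (D (x, y) (0, 1) - snd (0 :: real^'n, 1 :: real)))\<^sup>2) < c"
      using y by (meson le_less_trans)
  qed
  then show ?thesis by simp
qed (simp add: tr)

text \<open>
  Minimum principle for the difference in the smaller domain. On the graph of $h_1$ the value of
  $\varphi_2$ is not prescribed, which is why the inequality there is a hypothesis.
\<close>

lemma finite_energy_harmonic_comparison:
  fixes h\<^sub>1 h\<^sub>2 :: "real^'n \<Rightarrow> real"
  assumes \<phi>1: "finite_energy_harmonic h\<^sub>1 \<phi>\<^sub>1" and \<phi>2: "finite_energy_harmonic h\<^sub>2 \<phi>\<^sub>2"
    and le: "\<And>x. h\<^sub>1 x \<le> h\<^sub>2 x" and tr: "\<And>x. \<phi>\<^sub>1 (x, h\<^sub>1 x) \<le> \<phi>\<^sub>2 (x, h\<^sub>1 x)"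
    and z: "z \<in> fluid_domain h\<^sub>1"
  shows "\<phi>\<^sub>1 z \<le> \<phi>\<^sub>2 z"
proof -
  obtain D1 H1 B1 where h1: "continuous_on UNIV h\<^sub>1" "torus_periodic h\<^sub>1"
    and c1: "continuous_on (closed_fluid_domain h\<^sub>1) \<phi>\<^sub>1" and per1: "\<And>y. torus_periodic (\<lambda>x. \<phi>\<^sub>1 (x, y))"
    and d1: "second_derivs_on (fluid_domain h\<^sub>1) \<phi>\<^sub>1 D1 H1"
    and lap1: "\<forall>z\<in>fluid_domain h\<^sub>1. (\<Sum>b\<in>Basis. H1 z b b) = 0"
    and en1: "\<forall>y\<^sub>0. (\<forall>x. y\<^sub>0 < h\<^sub>1 x) \<longrightarrow> (\<forall>N\<ge>0. integral {y\<^sub>0 - N..y\<^sub>0} (slice_energy D1) \<le> B1)"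
    by (rule finite_energy_harmonicE[OF \<phi>1]) (rule that)
  note lap1 = lap1[rule_format] and en1 = en1[rule_format]
  obtain D2 H2 B2 where h2: "continuous_on UNIV h\<^sub>2" "torus_periodic h\<^sub>2"
    and c2: "continuous_on (closed_fluid_domain h\<^sub>2) \<phi>\<^sub>2"
    and per2: "\<And>y. torus_periodic (\<lambda>x. \<phi>\<^sub>2 (x, y))"
    and d2: "second_derivs_on (fluid_domain h\<^sub>2) \<phi>\<^sub>2 D2 H2"
    and lap2: "\<forall>z\<in>fluid_domain h\<^sub>2. (\<Sum>b\<in>Basis. H2 z b b) = 0"
    and en2: "\<forall>y\<^sub>0. (\<forall>x. y\<^sub>0 < h\<^sub>2 x) \<longrightarrow> (\<forall>N\<ge>0. integral {y\<^sub>0 - N..y\<^sub>0} (slice_energy D2) \<le> B2)"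
    by (rule finite_energy_harmonicE[OF \<phi>2]) (rule that)
  note lap2 = lap2[rule_format] and en2 = en2[rule_format]
  obtain y0 where y1: "\<And>x. y0 < h\<^sub>1 x" using torus_periodic_strict_lower_bound[OF h1] by blast
  then have y2: "y0 < h\<^sub>2 x" for x using le[of x] by (meson less_le_trans)
  have sub: "fluid_domain h\<^sub>1 \<subseteq> fluid_domain h\<^sub>2" "closed_fluid_domain h\<^sub>1 \<subseteq> closed_fluid_domain h\<^sub>2"
    using le by (auto simp: fluid_domain_def closed_fluid_domain_def intro: less_le_trans order_trans)
  note d = second_derivs_on_diff[OF d2 d1 sub(1) order_refl]
  have "0 \<le> \<phi>\<^sub>2 z - \<phi>\<^sub>1 z"
  proof (rule minimum_principle[OF h1 _ _ d _ _ _ z])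
    show "continuous_on (closed_fluid_domain h\<^sub>1) (\<lambda>z. \<phi>\<^sub>2 z - \<phi>\<^sub>1 z)"
      by (intro continuous_intros c1 continuous_on_subset[OF c2 sub(2)])
    show "torus_periodic (\<lambda>x. \<phi>\<^sub>2 (x, y) - \<phi>\<^sub>1 (x, y))" for y
      using per1 per2 by (simp add: torus_periodic_def)
    show "0 \<le> \<phi>\<^sub>2 (x, h\<^sub>1 x) - \<phi>\<^sub>1 (x, h\<^sub>1 x)" for x using tr by simp
    show "(\<Sum>b\<in>Basis. H2 z b b - H1 z b b) = 0" if "z \<in> fluid_domain h\<^sub>1" for z
      using lap1[OF that] lap2[of z] that sub(1) by (auto simp: sum_subtractf)
    fix c y\<^sub>1 :: real assume c: "0 < c"
    define J where "J y = 2 * slice_energy D1 y + 2 * slice_energy D2 y" for y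
    have cJ1: "continuous_on {..y0} (slice_energy D1)" and cJ2: "continuous_on {..y0} (slice_energy D2)"
      using slice_energy_continuous[OF d1 y1] slice_energy_continuous[OF d2 y2] by auto
    have int: "slice_energy D1 integrable_on {y0 - N..y0}" "slice_energy D2 integrable_on {y0 - N..y0}" for N
      by (rule integrable_continuous_real[OF continuous_on_subset[OF cJ1]]; force)
         (rule integrable_continuous_real[OF continuous_on_subset[OF cJ2]]; force)
    have cJ: "continuous_on {..y0} J" unfolding J_def by (intro continuous_intros cJ1 cJ2)
    have "integral {y0 - N..y0} J \<le> 2 * B1 + 2 * B2" if "N \<ge> 0" for N
      unfolding J_def using en1[OF y1 that] en2[OF y2 that] int
      by (subst integral_add) (auto intro: integrable_on_mult_right)
    moreover have "0 \<le> J y" for y by (simp add: J_def slice_energy_nonneg)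
    ultimately obtain y where y: "y < y\<^sub>1" "y \<le> y0" "J y < c"
      using bounded_energy_imp_small_slice[OF cJ _ _ c] by blast
    have yh1: "y < h\<^sub>1 x" and yh2: "y < h\<^sub>2 x" for x
      using y(2) y1[of x] y2[of x] by simp_all
    note i1 = vertical_derivative_slice_integrable[OF d1 yh1] and i2 = vertical_derivative_slice_integrable[OF d2 yh2]
    have "integral torus_cell (\<lambda>x. (max 0 (D2 (x, y) (0, 1) - D1 (x, y) (0, 1)))\<^sup>2)
       \<le> integral torus_cell (\<lambda>x. 2 * (D1 (x, y) (0, 1))\<^sup>2 + 2 * (D2 (x, y) (0, 1))\<^sup>2)"
    proof (rule positive_part_slice_le[OF d yh1])
      show "(\<lambda>x. 2 * (D1 (x, y) (0, 1))\<^sup>2 + 2 * (D2 (x, y) (0, 1))\<^sup>2) integrable_on torus_cell"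
        by (intro integrable_add integrable_on_mult_right i1 i2)
      fix x
      define a b where "a = D1 (x, y) (0, 1)" and "b = D2 (x, y) (0, 1)"
      have "(max 0 (b - a))\<^sup>2 \<le> (b - a)\<^sup>2" by (simp add: abs_le_square_iff[symmetric])
      also have "\<dots> \<le> (b - a)\<^sup>2 + (b + a)\<^sup>2" by simp
      also have "\<dots> = 2 * a\<^sup>2 + 2 * b\<^sup>2" by (simp add: power2_eq_square algebra_simps)
      finally show "(max 0 (D2 (x, y) (0, 1) - D1 (x, y) (0, 1)))\<^sup>2 \<le> 2 * (D1 (x, y) (0, 1))\<^sup>2 + 2 * (D2 (x, y) (0, 1))\<^sup>2"
        by (simp add: a_def b_def)
    qed
    also have "\<dots> = J y"
      unfolding J_def slice_energy_def by (subst integral_add) (auto intro: integrable_on_mult_right i1 i2)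
    finally show "\<exists>y<y\<^sub>1. integral torus_cell (\<lambda>x. (max 0 (D2 (x, y) (0, 1) - D1 (x, y) (0, 1)))\<^sup>2) < c"
      using y by (meson le_less_trans)
  qed
  then show ?thesis by simp
qed

text \<open>
  The two normals at the contact point agree because $h_2 - h_1$ is minimal there. The difference
  $\varphi_2 - \varphi_1$ is nonnegative below the lower graph and vanishes at the contact point, so
  it does not decrease along the direction $(\nabla h_1, -1)$, which points into the domain and is
  opposite to the direction of differentiation in $G$.
\<close>

lemma DN_comparison_at_contact:
  fixes h\<^sub>1 h\<^sub>2 :: "real^'n \<Rightarrow> real"
  assumes \<phi>1: "finite_energy_harmonic h\<^sub>1 \<phi>\<^sub>1" and tr1: "\<And>x. \<phi>\<^sub>1 (x, h\<^sub>1 x) = h\<^sub>1 x"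
    and \<phi>2: "finite_energy_harmonic h\<^sub>2 \<phi>\<^sub>2" and tr2: "\<And>x. \<phi>\<^sub>2 (x, h\<^sub>2 x) = h\<^sub>2 x"
    and le: "\<And>x. h\<^sub>1 x \<le> h\<^sub>2 x" and eq: "h\<^sub>1 x\<^sub>0 = h\<^sub>2 x\<^sub>0"
    and g1: "GDERIV h\<^sub>1 x\<^sub>0 :> g\<^sub>1" and g2: "GDERIV h\<^sub>2 x\<^sub>0 :> g\<^sub>2"
    and d1: "(\<phi>\<^sub>1 has_derivative (\<lambda>w. (p\<^sub>1, q\<^sub>1) \<bullet> w)) (at (x\<^sub>0, h\<^sub>1 x\<^sub>0) within closed_fluid_domain h\<^sub>1)"
    and d2: "(\<phi>\<^sub>2 has_derivative (\<lambda>w. (p\<^sub>2, q\<^sub>2) \<bullet> w)) (at (x\<^sub>0, h\<^sub>2 x\<^sub>0) within closed_fluid_domain h\<^sub>2)"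
  shows "q\<^sub>2 - g\<^sub>2 \<bullet> p\<^sub>2 \<le> q\<^sub>1 - g\<^sub>1 \<bullet> p\<^sub>1"
proof -
  have trle: "\<phi>\<^sub>1 (x, h\<^sub>1 x) \<le> \<phi>\<^sub>2 (x, h\<^sub>1 x)" for x
    using height_le_harmonic_extension[OF \<phi>2 tr2 le] by (simp add: tr1)
  have cmp: "\<phi>\<^sub>1 z \<le> \<phi>\<^sub>2 z" if "z \<in> closed_fluid_domain h\<^sub>1" for z
  proof (cases "z \<in> fluid_domain h\<^sub>1")
    case True
    then show ?thesis by (rule finite_energy_harmonic_comparison[OF \<phi>1 \<phi>2 le trle])
  next
    case False
    then have "z = (fst z, h\<^sub>1 (fst z))" using that by (auto simp: fluid_domain_def closed_fluid_domain_def)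
    then show ?thesis using trle by metis
  qed
  have g12: "g\<^sub>1 = g\<^sub>2"
  proof -
    have "((\<lambda>x. h\<^sub>2 x - h\<^sub>1 x) has_derivative (\<lambda>c. c \<bullet> g\<^sub>2 - c \<bullet> g\<^sub>1)) (at x\<^sub>0)"
      using g1 g2 unfolding gderiv_def by (intro has_derivative_diff)
    then have "(\<lambda>c. c \<bullet> g\<^sub>2 - c \<bullet> g\<^sub>1) = (\<lambda>c. 0)"
      by (rule has_derivative_local_min) (simp add: eq le)
    then have "(g\<^sub>2 - g\<^sub>1) \<bullet> g\<^sub>2 - (g\<^sub>2 - g\<^sub>1) \<bullet> g\<^sub>1 = 0" by metis
    then show ?thesis by (simp add: inner_diff_right[symmetric])
  qed
  \<comment> \<open>This path starts at the contact point and stays in the lower domain for small \<open>s\<close>.\<close>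
  define \<gamma> where "\<gamma> s = (x\<^sub>0 + s *\<^sub>R g\<^sub>1, h\<^sub>1 x\<^sub>0 - s)" for s
  have d\<gamma>: "(\<gamma> has_derivative (\<lambda>s. (s *\<^sub>R g\<^sub>1, - s))) (at 0 within S)" for S
    unfolding \<gamma>_def by (auto intro!: derivative_eq_intros)
  have "((\<lambda>s. h\<^sub>1 (x\<^sub>0 + s *\<^sub>R g\<^sub>1) + s) has_real_derivative (g\<^sub>1 \<bullet> g\<^sub>1 + 1)) (at 0)"
  proof -
    have "((\<lambda>s. x\<^sub>0 + s *\<^sub>R g\<^sub>1) has_derivative (\<lambda>s. s *\<^sub>R g\<^sub>1)) (at 0)"
      by (auto intro!: derivative_eq_intros)
    from has_derivative_compose[OF this, of h\<^sub>1 "\<lambda>c. c \<bullet> g\<^sub>1"] g1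
    have "((\<lambda>s. h\<^sub>1 (x\<^sub>0 + s *\<^sub>R g\<^sub>1)) has_derivative (\<lambda>s. (s *\<^sub>R g\<^sub>1) \<bullet> g\<^sub>1)) (at 0)"
      by (simp add: gderiv_def)
    from has_derivative_add[OF this has_derivative_ident]
    show ?thesis unfolding has_field_derivative_def by (rule has_derivative_eq_rhs) (auto simp: algebra_simps)
  qed
  moreover have "g\<^sub>1 \<bullet> g\<^sub>1 + 1 > 0" using inner_ge_zero[of g\<^sub>1] by linarith
  ultimately obtain e where e: "e > 0" "\<And>s. 0 < s \<Longrightarrow> s < e \<Longrightarrow> h\<^sub>1 x\<^sub>0 < h\<^sub>1 (x\<^sub>0 + s *\<^sub>R g\<^sub>1) + s"
    using has_real_derivative_pos_inc_right[of "\<lambda>s. h\<^sub>1 (x\<^sub>0 + s *\<^sub>R g\<^sub>1) + s" _ 0 UNIV] by auto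
  have in\<Omega>: "\<gamma> s \<in> closed_fluid_domain h\<^sub>1" if "s \<in> {0..<e}" for s
    using that e(2)[of s] by (cases "s = 0") (auto simp: \<gamma>_def closed_fluid_domain_def)
  have sub: "closed_fluid_domain h\<^sub>1 \<subseteq> closed_fluid_domain h\<^sub>2"
    using le by (auto simp: closed_fluid_domain_def intro: order_trans)
  have im: "\<gamma> ` {0..<e} \<subseteq> closed_fluid_domain h\<^sub>1" using in\<Omega> by blast
  have \<gamma>0: "\<gamma> 0 = (x\<^sub>0, h\<^sub>1 x\<^sub>0)" "\<gamma> 0 = (x\<^sub>0, h\<^sub>2 x\<^sub>0)" using eq by (simp_all add: \<gamma>_def)
  have "((\<lambda>z. \<phi>\<^sub>2 z - \<phi>\<^sub>1 z) has_derivative (\<lambda>w. (p\<^sub>2, q\<^sub>2) \<bullet> w - (p\<^sub>1, q\<^sub>1) \<bullet> w)) (at (\<gamma> 0) within \<gamma> ` {0..<e})"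
    by (rule has_derivative_diff[OF has_derivative_subset[OF d2[folded \<gamma>0(2)] order_trans[OF im sub]]
          has_derivative_subset[OF d1[folded \<gamma>0(1)] im]])
  from has_derivative_in_compose[OF d\<gamma> this]
  have "((\<lambda>s. \<phi>\<^sub>2 (\<gamma> s) - \<phi>\<^sub>1 (\<gamma> s)) has_real_derivative ((p\<^sub>2 - p\<^sub>1) \<bullet> g\<^sub>1 - (q\<^sub>2 - q\<^sub>1))) (at 0 within {0..<e})"
    unfolding has_field_derivative_def
    by (rule has_derivative_eq_rhs) (auto simp: algebra_simps inner_diff_left)
  moreover have "\<not> (\<phi>\<^sub>2 (\<gamma> 0) - \<phi>\<^sub>1 (\<gamma> 0) > \<phi>\<^sub>2 (\<gamma> s) - \<phi>\<^sub>1 (\<gamma> s))" if "s \<in> {0..<e}" for s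
  proof -
    have "\<phi>\<^sub>2 (\<gamma> 0) - \<phi>\<^sub>1 (\<gamma> 0) = 0" using eq tr1[of x\<^sub>0] tr2[of x\<^sub>0] by (simp add: \<gamma>_def)
    then show ?thesis using cmp[OF in\<Omega>[OF that]] by simp
  qed
  ultimately have "0 \<le> (p\<^sub>2 - p\<^sub>1) \<bullet> g\<^sub>1 - (q\<^sub>2 - q\<^sub>1)"
  proof (intro leI notI)
    assume "((\<lambda>s. \<phi>\<^sub>2 (\<gamma> s) - \<phi>\<^sub>1 (\<gamma> s)) has_real_derivative ((p\<^sub>2 - p\<^sub>1) \<bullet> g\<^sub>1 - (q\<^sub>2 - q\<^sub>1))) (at 0 within {0..<e})"
      and neg: "(p\<^sub>2 - p\<^sub>1) \<bullet> g\<^sub>1 - (q\<^sub>2 - q\<^sub>1) < 0"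
      and no: "\<And>s. s \<in> {0..<e} \<Longrightarrow> \<not> (\<phi>\<^sub>2 (\<gamma> 0) - \<phi>\<^sub>1 (\<gamma> 0) > \<phi>\<^sub>2 (\<gamma> s) - \<phi>\<^sub>1 (\<gamma> s))"
    from has_real_derivative_neg_dec_right[OF this(1) neg]
    obtain d where d: "d > 0" "\<And>s. s > 0 \<Longrightarrow> s \<in> {0..<e} \<Longrightarrow> s < d \<Longrightarrow> \<phi>\<^sub>2 (\<gamma> 0) - \<phi>\<^sub>1 (\<gamma> 0) > \<phi>\<^sub>2 (\<gamma> s) - \<phi>\<^sub>1 (\<gamma> s)"
      by auto
    define s where "s = min d e / 2"
    have "s > 0" "s < e" "s < d" using d(1) e(1) by (auto simp: s_def min_def)
    then show False using d(2)[of s] no[of s] by simp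
  qed
  then show ?thesis by (simp add: g12 inner_diff_right inner_commute[of _ g\<^sub>2])
qed

section \<open>A uniform bound by Sobolev norms\<close>

lemma integrable_on_torus_cell:
  fixes f :: "real^'n \<Rightarrow> 'b::banach"
  shows "continuous_on UNIV f \<Longrightarrow> f integrable_on torus_cell"
  unfolding torus_cell_eq_cbox by (intro integrable_continuous) (auto intro: continuous_on_subset)

definition fourier_mode :: "int^'n \<Rightarrow> real^'n \<Rightarrow> complex" where
  "fourier_mode k x = cis (\<Sum>i\<in>UNIV. of_int (k $ i) * x $ i)"

lemma fourier_mode_add: "fourier_mode (k + l) x = fourier_mode k x * fourier_mode l x"
  by (simp add: fourier_mode_def cis_mult sum.distrib distrib_right)

lemma fourier_mode_shift: "fourier_mode k (x + v) = fourier_mode k x * fourier_mode k v"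
  by (simp add: fourier_mode_def cis_mult sum.distrib distrib_left)

lemma fourier_mode_0: "fourier_mode 0 x = 1"
  by (simp add: fourier_mode_def)

lemma fourier_mode_axis: "fourier_mode k (axis i c) = cis (of_int (k $ i) * c)"
  by (simp add: fourier_mode_def axis_def if_distrib cong: if_cong)

lemma norm_fourier_mode: "norm (fourier_mode k x) = 1"
  by (simp add: fourier_mode_def)

lemma continuous_on_fourier_mode: "continuous_on S (fourier_mode k)"
  unfolding fourier_mode_def[abs_def] by (intro continuous_intros)

lemma torus_periodic_fourier_mode: "torus_periodic (fourier_mode k)"
proof -
  have "fourier_mode k (lattice_vec m) = 1" for m
  proof -
    have "(\<Sum>i\<in>UNIV. of_int (k $ i) * lattice_vec m $ i) = 2 * pi * of_int (\<Sum>i\<in>UNIV. k $ i * m $ i)"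
      by (simp add: lattice_vec_def sum_distrib_left algebra_simps)
    moreover have "cis (2 * pi * of_int (\<Sum>i\<in>UNIV. k $ i * m $ i)) = 1"
      by (rule cis_multiple_2pi) (rule Ints_of_int)
    ultimately show ?thesis by (simp only: fourier_mode_def)
  qed
  then show ?thesis by (simp add: torus_periodic_def fourier_mode_shift)
qed

text \<open>
  A shift by half a period in a direction in which the mode oscillates changes its sign.
\<close>

lemma integral_fourier_mode:
  assumes "k \<noteq> 0"
  shows "integral torus_cell (fourier_mode k) = 0"
proof -
  obtain i where i: "k $ i \<noteq> 0" using assms by (auto simp: vec_eq_iff)
  define v where "v = axis i (pi / of_int (k $ i))"
  have "fourier_mode k v = -1" using i by (simp add: v_def fourier_mode_axis)
  then have "fourier_mode k (x + v) = - fourier_mode k x" for x by (simp add: fourier_mode_shift)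
  then have "integral torus_cell (fourier_mode k) = - integral torus_cell (fourier_mode k)"
    using integral_torus_cell_shift[OF continuous_on_fourier_mode torus_periodic_fourier_mode, of k v] by simp
  then show ?thesis by simp
qed

text \<open>
  The argument carries the index type, on which the dimension depends.
\<close>

definition torus_volume :: "'n::finite itself \<Rightarrow> real" where
  "torus_volume _ = (2 * pi) ^ CARD('n)"

lemma torus_volume_pos: "0 < torus_volume TYPE('n::finite)"
  by (simp add: torus_volume_def)

lemma integral_torus_cell_const:
  "integral (torus_cell :: (real^'n) set) (\<lambda>_. c) = torus_volume TYPE('n) *\<^sub>R (c :: 'b::euclidean_space)"
proof -
  have "cbox 0 (\<chi> i. 2 * pi) \<noteq> ({} :: (real^'n) set)"
    using torus_cell_representative by (force simp: torus_cell_eq_cbox[symmetric])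
  then show ?thesis
    by (simp add: torus_cell_eq_cbox content_cbox_cart torus_volume_def)
qed

lemma fourier_coeff_eq_integral:
  fixes f :: "real^'n \<Rightarrow> real"
  assumes f: "continuous_on UNIV f"
  shows "torus_volume TYPE('n) *\<^sub>R fourier_coeff f k =
    integral torus_cell (\<lambda>x. of_real (f x) * fourier_mode (- k) x)"
proof -
  have "cis (- (\<Sum>i\<in>UNIV. of_int (k $ i) * x $ i)) * of_real (f x) = of_real (f x) * fourier_mode (- k) x" for x
    by (simp add: fourier_mode_def sum_negf)
  moreover have "(\<lambda>x. of_real (f x) * fourier_mode (- k) x) absolutely_integrable_on torus_cell"
    unfolding torus_cell_eq_cbox
    by (intro absolutely_integrable_continuous continuous_intros continuous_on_fourier_mode)
      (auto intro: continuous_on_subset[OF f])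
  ultimately show ?thesis
    using torus_volume_pos[where 'n='n]
    by (simp only: fourier_coeff_def set_lebesgue_integral_eq_integral) (simp add: torus_volume_def)
qed

text \<open>
  Closure under products is an induction on both factors with this definition; the expansion with
  distinct frequencies is recovered in \<open>trig_poly_expansion\<close>.
\<close>

inductive trig_poly :: "(real^'n \<Rightarrow> complex) \<Rightarrow> bool" where
  mode: "trig_poly (\<lambda>x. c * fourier_mode k x)"
| add: "trig_poly p \<Longrightarrow> trig_poly q \<Longrightarrow> trig_poly (\<lambda>x. p x + q x)"

lemma trig_poly_mult: "trig_poly p \<Longrightarrow> trig_poly q \<Longrightarrow> trig_poly (\<lambda>x. p x * q x)"
proof (induction p rule: trig_poly.induct)
  case (mode c k)
  then show ?case
  proof (induction q rule: trig_poly.induct)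
    case (mode d l)
    show ?case using trig_poly.mode[of "c * d" "k + l"] by (simp add: fourier_mode_add mult_ac)
  qed (simp add: distrib_left trig_poly.add)
qed (simp add: distrib_right trig_poly.add)

lemma trig_poly_const: "trig_poly (\<lambda>x. c)"
  using trig_poly.mode[of c 0] by (simp add: fourier_mode_0)

lemma trig_poly_power: "trig_poly p \<Longrightarrow> trig_poly (\<lambda>x. p x ^ N)"
  by (induction N) (auto intro: trig_poly_const trig_poly_mult)

lemma trig_poly_sum: "finite I \<Longrightarrow> (\<And>i. i \<in> I \<Longrightarrow> trig_poly (p i)) \<Longrightarrow> trig_poly (\<lambda>x. \<Sum>i\<in>I. p i x)"
  by (induction I rule: finite_induct) (auto intro: trig_poly_const trig_poly.add)

lemma trig_poly_expansion:
  assumes "trig_poly p"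
  obtains F c where "finite F" "p = (\<lambda>x. \<Sum>k\<in>F. c k * fourier_mode k x)"
proof -
  have "\<exists>F c. finite F \<and> (\<forall>k. k \<notin> F \<longrightarrow> c k = 0) \<and> p = (\<lambda>x. \<Sum>k\<in>F. c k * fourier_mode k x)"
    using assms
  proof (induction p rule: trig_poly.induct)
    case (mode c k)
    show ?case by (rule exI[of _ "{k}"], rule exI[of _ "\<lambda>l. if l = k then c else 0"]) auto
  next
    case (add p q)
    obtain F c where p: "finite F" "\<forall>k. k \<notin> F \<longrightarrow> c k = 0" "p = (\<lambda>x. \<Sum>k\<in>F. c k * fourier_mode k x)"
      using add.IH(1) by blast
    obtain G d where q: "finite G" "\<forall>k. k \<notin> G \<longrightarrow> d k = 0" "q = (\<lambda>x. \<Sum>k\<in>G. d k * fourier_mode k x)"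
      using add.IH(2) by blast
    have "p x = (\<Sum>k\<in>F \<union> G. c k * fourier_mode k x)" for x
      unfolding p(3) by (rule sum.mono_neutral_left) (use p q in auto)
    moreover have "q x = (\<Sum>k\<in>F \<union> G. d k * fourier_mode k x)" for x
      unfolding q(3) by (rule sum.mono_neutral_left) (use p q in auto)
    ultimately have "(\<lambda>x. p x + q x) = (\<lambda>x. \<Sum>k\<in>F \<union> G. (c k + d k) * fourier_mode k x)"
      by (simp add: sum.distrib distrib_right)
    then show ?case
      using p(1,2) q(1,2) by (intro exI[of _ "F \<union> G"] exI[of _ "\<lambda>k. c k + d k"]) auto
  qed
  then show thesis using that by blast
qed

text \<open>
  Expanding $\kappa$, the left-hand side is a sum of products of Fourier coefficients of $\kappa$ and
  of $f$. As $\kappa \ge 0$, none of its Fourier coefficients exceeds its mean in modulus.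
\<close>

lemma integral_mult_nonneg_trig_poly_le:
  fixes f \<kappa> :: "real^'n \<Rightarrow> real"
  assumes f: "continuous_on UNIV f" and \<kappa>: "continuous_on UNIV \<kappa>" "\<And>x. 0 \<le> \<kappa> x"
    and trig: "trig_poly (\<lambda>x. of_real (\<kappa> x))"
    and A: "\<And>F. finite F \<Longrightarrow> (\<Sum>k\<in>F. norm (fourier_coeff f k)) \<le> A"
  shows "integral torus_cell (\<lambda>x. f x * \<kappa> x) \<le> A * integral torus_cell \<kappa>"
proof -
  define V where "V = torus_volume TYPE('n)"
  have V: "V > 0" using torus_volume_pos by (simp add: V_def)
  obtain F c where F: "finite F" and exp: "\<And>x. of_real (\<kappa> x) = (\<Sum>k\<in>F. c k * fourier_mode k x)"
    using trig_poly_expansion[OF trig] by metis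
  note cont = continuous_intros continuous_on_fourier_mode
  \<comment> \<open>By orthogonality, \<open>c k * V\<close> is the integral of \<open>\<kappa>\<close> against a mode of modulus 1.\<close>
  have coeff: "norm (c k) * V \<le> integral torus_cell \<kappa>" if k: "k \<in> F" for k
  proof -
    have "integral torus_cell (\<lambda>x. of_real (\<kappa> x) * fourier_mode (- k) x)
        = integral torus_cell (\<lambda>x. \<Sum>l\<in>F. c l * fourier_mode (l - k) x)"
      unfolding exp sum_distrib_right mult.assoc diff_conv_add_uminus fourier_mode_add ..
    also have "\<dots> = (\<Sum>l\<in>F. c l * integral torus_cell (fourier_mode (l - k)))"
      by (subst integral_sum[OF F]) (auto intro!: integrable_on_torus_cell cont)
    also have "\<dots> = (\<Sum>l\<in>F. if l = k then c k * of_real V else 0)"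
    proof (intro sum.cong refl)
      show "c l * integral torus_cell (fourier_mode (l - k)) = (if l = k then c k * of_real V else 0)" for l
        using integral_fourier_mode[of "l - k"] integral_torus_cell_const[where c = "1 :: complex" and 'n='n]
        by (auto simp: fourier_mode_0[abs_def] V_def scaleR_conv_of_real)
    qed
    also have "\<dots> = c k * of_real V" using F k by simp
    finally have "norm (c k) * V = norm (integral torus_cell (\<lambda>x. of_real (\<kappa> x) * fourier_mode (- k) x))"
      using V by (simp add: norm_mult)
    also have "\<dots> \<le> integral torus_cell \<kappa>"
      by (rule Henstock_Kurzweil_Integration.integral_norm_bound_integral)
        (auto intro!: integrable_on_torus_cell cont \<kappa> simp: norm_mult norm_fourier_mode \<kappa>(2))
    finally show ?thesis .
  qed
  have "of_real (integral torus_cell (\<lambda>x. f x * \<kappa> x)) = integral torus_cell (\<lambda>x. complex_of_real (f x * \<kappa> x))"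
    by (subst integral_linear[OF _ bounded_linear_of_real, unfolded o_def, symmetric])
      (auto intro!: integrable_on_torus_cell cont f \<kappa>)
  also have "\<dots> = integral torus_cell (\<lambda>x. \<Sum>k\<in>F. c k * (of_real (f x) * fourier_mode k x))"
    by (simp add: exp sum_distrib_left mult_ac)
  also have "\<dots> = (\<Sum>k\<in>F. c k * integral torus_cell (\<lambda>x. of_real (f x) * fourier_mode k x))"
    by (subst integral_sum[OF F]) (auto intro!: integrable_on_torus_cell cont f)
  also have "\<dots> = (\<Sum>k\<in>F. c k * V *\<^sub>R fourier_coeff f (- k))"
    using fourier_coeff_eq_integral[OF f, of "- k" for k] by (simp add: V_def)
  finally have eq: "of_real (integral torus_cell (\<lambda>x. f x * \<kappa> x)) = (\<Sum>k\<in>F. c k * V *\<^sub>R fourier_coeff f (- k))" .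
  have int0: "0 \<le> integral torus_cell \<kappa>"
    by (rule integral_nonneg) (auto intro!: integrable_on_torus_cell \<kappa>)
  have "integral torus_cell (\<lambda>x. f x * \<kappa> x) \<le> norm (complex_of_real (integral torus_cell (\<lambda>x. f x * \<kappa> x)))"
    by simp
  also have "\<dots> \<le> (\<Sum>k\<in>F. norm (c k * V *\<^sub>R fourier_coeff f (- k)))"
    unfolding eq by (rule norm_sum)
  also have "\<dots> \<le> (\<Sum>k\<in>F. integral torus_cell \<kappa> * norm (fourier_coeff f (- k)))"
    by (rule sum_mono)
      (use coeff V in \<open>auto simp: norm_mult mult.assoc[symmetric] mult.commute[of V] intro!: mult_right_mono\<close>)
  also have "\<dots> = integral torus_cell \<kappa> * (\<Sum>k\<in>uminus ` F. norm (fourier_coeff f k))"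
    by (simp add: sum_distrib_left sum.reindex)
  also have "\<dots> \<le> integral torus_cell \<kappa> * A"
    by (rule mult_left_mono[OF A int0]) (use F in simp)
  finally show ?thesis by (simp add: mult.commute)
qed

text \<open>
  If $f(x_0) > A$, then \<open>integral_mult_nonneg_trig_poly_le\<close> fails for
  $\kappa = P^N$ with $N$ large, where $P(x) = \sum_i (1 + \cos(x_i - x_{0,i}))$. Indeed $P \ge 0$ has
  its strict maximum over the cell at $x_0$, provided that $x_0$ is interior: on the boundary of the
  cell other points may represent the same point of the torus. So $P^N$
  concentrates where $f > A$.
\<close>

lemma fourier_sum_bounds_function_on_box:
  fixes f :: "real^'n \<Rightarrow> real"
  assumes f: "continuous_on UNIV f"
    and A: "\<And>F. finite F \<Longrightarrow> (\<Sum>k\<in>F. norm (fourier_coeff f k)) \<le> A"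
    and x0: "x\<^sub>0 \<in> box 0 (\<chi> i. 2 * pi)"
  shows "f x\<^sub>0 \<le> A"
proof (rule ccontr)
  assume "\<not> f x\<^sub>0 \<le> A"
  define \<eta> where "\<eta> = (f x\<^sub>0 - A) / 2"
  have \<eta>: "\<eta> > 0" "A + \<eta> < f x\<^sub>0" using \<open>\<not> f x\<^sub>0 \<le> A\<close> by (auto simp: \<eta>_def field_simps)
  define n where "n = real CARD('n)"
  define P where "P x = (\<Sum>i\<in>UNIV. 1 + cos (x $ i - x\<^sub>0 $ i))" for x
  have cP: "continuous_on S P" for S unfolding P_def[abs_def] by (intro continuous_intros)
  have "0 \<le> 1 + cos \<theta>" for \<theta> :: real using cos_ge_minus_one[of \<theta>] by linarith
  then have P0: "0 \<le> P x" for x unfolding P_def by (intro sum_nonneg)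
  have Px0: "P x\<^sub>0 = 2 * n" by (simp add: P_def n_def)
  have P_less: "P x < 2 * n" if x: "x \<in> torus_cell" "x \<noteq> x\<^sub>0" for x
  proof -
    obtain i where i: "x $ i \<noteq> x\<^sub>0 $ i" using x(2) by (auto simp: vec_eq_iff)
    define t where "t = x $ i - x\<^sub>0 $ i"
    have t: "t \<noteq> 0" "\<bar>t\<bar> < 2 * pi" using i x(1) x0 
      by (auto simp: t_def torus_cell_def mem_box_cart abs_less_iff) (smt (verit, ccfv_SIG))+
    have "cos t \<noteq> 1"
    proof
      assume "cos t = 1"
      then obtain m :: int where m: "t = of_int m * 2 * pi" using cos_one_2pi_int by blast
      then have "\<bar>real_of_int m\<bar> < 1" using t(2) by (simp add: abs_mult)
      then have "m = 0" by linarith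
      then show False using m t(1) by simp
    qed
    then have "cos t < 1" by (simp add: less_le)
    then have "P x < (\<Sum>i\<in>(UNIV :: 'n set). 2)"
      unfolding P_def by (intro sum_strict_mono_ex1) (auto simp: t_def intro!: exI[of _ i])
    then show ?thesis by (simp add: n_def)
  qed
  define U where "U = {x. A + \<eta> < f x}"
  have oU: "open U" unfolding U_def using f by (intro open_Collect_less continuous_intros)
  have cell: "compact (torus_cell :: (real^'n) set)" by (simp add: torus_cell_eq_cbox)
  have n: "n > 0" by (simp add: n_def)
  have boxcell: "box 0 (\<chi> i. 2 * pi) \<subseteq> (torus_cell :: (real^'n) set)"
    unfolding torus_cell_eq_cbox by (rule box_subset_cbox)
  obtain a where a: "0 \<le> a" "a < 2 * n" "\<And>x. x \<in> torus_cell \<Longrightarrow> x \<notin> U \<Longrightarrow> P x \<le> a"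
  proof (cases "torus_cell - U = {}")
    case True
    then show thesis using that[of 0] n by auto
  next
    case False
    obtain z where z: "z \<in> torus_cell - U" "\<forall>x\<in>torus_cell - U. P x \<le> P z"
      using continuous_attains_sup[OF compact_diff[OF cell oU] False cP] by blast
    then have "z \<noteq> x\<^sub>0" using \<eta> by (auto simp: U_def)
    then show thesis using that[of "P z"] z P0 P_less[of z] by auto
  qed
  \<comment> \<open>Outside \<open>U\<close> the kernel is at most \<open>a ^ N\<close>; near \<open>x\<^sub>0\<close> it is at least \<open>b ^ N\<close> for any \<open>b < 2 * n\<close>.\<close>
  define b where "b = (a + 2 * n) / 2"
  have b: "a < b" "b < 2 * n" using a by (auto simp: b_def)
  define O' where "O' = box 0 (\<chi> i. 2 * pi) \<inter> U \<inter> {x. b < P x}"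
  have "open O'" unfolding O'_def using cP by (intro open_Int open_box oU open_Collect_less continuous_intros)
  moreover have "x\<^sub>0 \<in> O'" using x0 \<eta> b Px0 by (auto simp: O'_def U_def)
  ultimately obtain c d where cd: "cbox c d \<subseteq> O'" "\<forall>i\<in>Basis. c \<bullet> i < d \<bullet> i"
    using open_contains_cbox by metis
  define v where "v = measure lborel (cbox c d)"
  have v: "v > 0" using cd(2) by (simp add: v_def content_pos_lt)
  obtain M where M: "0 \<le> M" "\<And>x. x \<in> torus_cell \<Longrightarrow> \<bar>f x - A\<bar> \<le> M"
  proof -
    have "continuous_on torus_cell (\<lambda>x. \<bar>f x - A\<bar>)"
      by (intro continuous_intros continuous_on_subset[OF f]) auto
    from continuous_attains_sup[OF cell _ this] x0 boxcell
    obtain z where "\<forall>x\<in>torus_cell. \<bar>f x - A\<bar> \<le> \<bar>f z - A\<bar>" by blast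
    then show thesis using that[of "\<bar>f z - A\<bar>"] by auto
  qed
  define V where "V = torus_volume TYPE('n)"
  have V: "V > 0" using torus_volume_pos by (simp add: V_def)
  have bpos: "b > 0" using a b by linarith
  obtain N where N: "(a / b) ^ N < \<eta> * v / (M * V + 1)"
    using real_arch_pow_inv[of "\<eta> * v / (M * V + 1)" "a / b"] \<eta>(1) v M(1) V b bpos
    by (auto simp: add_nonneg_pos)
  have MV: "M * V + 1 > 0" using M(1) V by (simp add: add_nonneg_pos)
  have N': "M * a ^ N * V < \<eta> * b ^ N * v"
  proof -
    have "(M * V + 1) * a ^ N < \<eta> * v * b ^ N"
      using N MV bpos by (simp add: power_divide field_simps)
    moreover have "0 \<le> a ^ N" using a by simp
    ultimately show ?thesis by (simp add: algebra_simps)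
  qed
  define \<kappa> where "\<kappa> x = P x ^ N" for x
  have c\<kappa>: "continuous_on S \<kappa>" for S unfolding \<kappa>_def[abs_def] by (intro continuous_intros cP)
  have "trig_poly (\<lambda>x. complex_of_real (P x))"
  proof -
    have "complex_of_real (1 + cos (x $ i - x\<^sub>0 $ i)) =
        (1 + cis (- x\<^sub>0 $ i) / 2 * fourier_mode (axis i 1) x) + cis (x\<^sub>0 $ i) / 2 * fourier_mode (axis i (-1)) x" for x i
    proof -
      have m: "fourier_mode (axis i m) x = cis (of_int m * x $ i)" for m
      proof -
        have "(\<Sum>j\<in>UNIV. of_int (axis i m $ j) * x $ j) = (\<Sum>j\<in>UNIV. if j = i then of_int m * x $ i else 0)"
          by (intro sum.cong) (auto simp: axis_def)
        then show ?thesis by (simp add: fourier_mode_def)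
      qed
      have "cis (- x\<^sub>0 $ i) * cis (x $ i) = cis (x $ i - x\<^sub>0 $ i)" "cis (x\<^sub>0 $ i) * cis (- x $ i) = cis (- (x $ i - x\<^sub>0 $ i))"
        by (simp_all add: cis_mult)
      then show ?thesis by (simp add: m) (simp add: complex_eq_iff)
    qed
    then show ?thesis
      unfolding P_def of_real_sum
      by (simp only:) (intro trig_poly_sum trig_poly.add trig_poly.mode trig_poly_const finite)
  qed
  then have trig: "trig_poly (\<lambda>x. complex_of_real (\<kappa> x))"
    unfolding \<kappa>_def of_real_power by (rule trig_poly_power)
  have up: "integral torus_cell (\<lambda>x. f x * \<kappa> x) \<le> A * integral torus_cell \<kappa>"
    by (rule integral_mult_nonneg_trig_poly_le[OF f c\<kappa> _ trig A]) (auto simp: \<kappa>_def P0)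
  \<comment> \<open>The added constant compensates the negative values of \<open>f - A\<close> outside \<open>U\<close>, so that the integral of
    \<open>w\<close> over the cell is at least its integral over a small box around \<open>x\<^sub>0\<close>.\<close>
  define w where "w x = (f x * \<kappa> x - A * \<kappa> x) + M * a ^ N" for x
  have w_eq: "w x = (f x - A) * P x ^ N + M * a ^ N" for x by (simp add: w_def \<kappa>_def algebra_simps)
  have cw: "continuous_on UNIV w" unfolding w_def[abs_def] by (intro continuous_intros f c\<kappa>)
  have w_nonneg: "0 \<le> w x" if x: "x \<in> torus_cell" for x
  proof (cases "x \<in> U")
    case True
    then show ?thesis using \<eta>(1) M(1) a(1) P0[of x] by (simp add: w_eq U_def)
  next
    case False
    have "\<bar>(f x - A) * P x ^ N\<bar> \<le> M * a ^ N"
      unfolding abs_mult using M x P0[of x] a(3)[OF x False]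
      by (intro mult_mono) (auto simp: power_abs intro: power_mono)
    then show ?thesis by (simp add: w_eq)
  qed
  have w_ge: "\<eta> * b ^ N \<le> w x" if "x \<in> cbox c d" for x
  proof -
    have x: "x \<in> U" "b < P x" using that cd(1) by (auto simp: O'_def)
    have "\<eta> * b ^ N \<le> (f x - A) * P x ^ N"
      using x \<eta>(1) bpos by (intro mult_mono power_mono) (auto simp: U_def)
    moreover have "0 \<le> M * a ^ N" using M(1) a(1) by simp
    ultimately show ?thesis by (simp add: w_eq)
  qed
  have sub: "cbox c d \<subseteq> torus_cell" using cd(1) boxcell by (auto simp: O'_def)
  have iw: "w integrable_on cbox p q" for p q
    by (intro integrable_continuous continuous_on_subset[OF cw]) auto
  have "\<eta> * b ^ N * v = integral (cbox c d) (\<lambda>_. \<eta> * b ^ N)" by (simp add: v_def)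
  also have "\<dots> \<le> integral (cbox c d) w" by (rule integral_le) (use iw w_ge in auto)
  also have "\<dots> \<le> integral torus_cell w"
    by (rule integral_subset_le[OF sub]) (use iw w_nonneg in \<open>auto simp: torus_cell_eq_cbox\<close>)
  also have "\<dots> = (integral torus_cell (\<lambda>x. f x * \<kappa> x) - A * integral torus_cell \<kappa>) + M * a ^ N * V"
  proof -
    note i = integrable_on_torus_cell
    have "integral torus_cell w = integral torus_cell (\<lambda>x. f x * \<kappa> x - A * \<kappa> x) + integral torus_cell (\<lambda>x::real^'n. M * a ^ N)"
      unfolding w_def by (rule integral_add) (intro i continuous_intros f c\<kappa>)+
    also have "integral torus_cell (\<lambda>x. f x * \<kappa> x - A * \<kappa> x) = integral torus_cell (\<lambda>x. f x * \<kappa> x) - integral torus_cell (\<lambda>x. A * \<kappa> x)"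
      by (rule integral_diff) (intro i continuous_intros f c\<kappa>)+
    also have "integral torus_cell (\<lambda>x::real^'n. M * a ^ N) = M * a ^ N * V"
      unfolding integral_torus_cell_const by (simp add: V_def)
    finally show ?thesis by simp
  qed
  also have "\<dots> \<le> M * a ^ N * V" using up by simp
  finally show False using N' by simp
qed

lemma fourier_coeff_diff:
  fixes f g :: "real^'n \<Rightarrow> real"
  assumes "continuous_on UNIV f" "continuous_on UNIV g"
  shows "fourier_coeff (\<lambda>x. f x - g x) k = fourier_coeff f k - fourier_coeff g k"
proof -
  have "torus_volume TYPE('n) *\<^sub>R fourier_coeff (\<lambda>x. f x - g x) k =
      integral torus_cell (\<lambda>x. of_real (f x) * fourier_mode (- k) x - of_real (g x) * fourier_mode (- k) x)"
    using fourier_coeff_eq_integral[of "\<lambda>x. f x - g x" k] assms 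
    by (simp add: continuous_on_diff left_diff_distrib)
  also have "\<dots> = torus_volume TYPE('n) *\<^sub>R (fourier_coeff f k - fourier_coeff g k)"
    unfolding scaleR_diff_right fourier_coeff_eq_integral[OF assms(1)] fourier_coeff_eq_integral[OF assms(2)]
    by (intro integral_diff integrable_on_torus_cell continuous_intros continuous_on_fourier_mode assms)
  finally show ?thesis using torus_volume_pos[where 'n='n] by simp
qed

lemma fourier_sum_bounds_function:
  fixes f :: "real^'n \<Rightarrow> real"
  assumes f: "continuous_on UNIV f" and per: "torus_periodic f"
    and A: "\<And>F. finite F \<Longrightarrow> (\<Sum>k\<in>F. norm (fourier_coeff f k)) \<le> A"
  shows "\<bar>f x\<bar> \<le> A"
proof -
  have le: "g x \<le> A" if g: "continuous_on UNIV g" "torus_periodic g"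
    and A: "\<And>F. finite F \<Longrightarrow> (\<Sum>k\<in>F. norm (fourier_coeff g k)) \<le> A" for g :: "real^'n \<Rightarrow> real"
  proof -
    obtain k where k: "x + lattice_vec k \<in> torus_cell" using torus_cell_representative by blast
    have "box 0 (\<chi> i. 2 * pi) \<noteq> ({} :: (real^'n) set)"
      by (auto simp: box_ne_empty inner_axis Basis_vec_def)
    then have cl: "closure (box 0 (\<chi> i. 2 * pi)) = (torus_cell :: (real^'n) set)"
      by (simp add: closure_box torus_cell_eq_cbox)
    have "g (x + lattice_vec k) \<le> A"
      by (rule continuous_le_on_closure[where S = "box 0 (\<chi> i. 2 * pi)"])
        (auto simp: cl k intro: continuous_on_subset[OF g(1)] fourier_sum_bounds_function_on_box[OF g(1) A])
    then show ?thesis using torus_periodicD[OF g(2)] by simp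
  qed
  have "f x \<le> A" by (rule le[OF f per A])
  moreover have "- f x \<le> A"
  proof (rule le)
    show "continuous_on UNIV (\<lambda>x. - f x)" using f by (rule continuous_on_minus)
    show "torus_periodic (\<lambda>x. - f x)" using per by (simp add: torus_periodic_def)
    have "fourier_coeff (\<lambda>x::real^'n. 0) k = 0" for k by (simp add: fourier_coeff_def)
    then have "fourier_coeff (\<lambda>x. - f x) k = - fourier_coeff f k" for k
      using fourier_coeff_diff[of "\<lambda>_. 0" f k] f by simp
    then show "(\<Sum>k\<in>F. norm (fourier_coeff (\<lambda>x. - f x) k)) \<le> A" if "finite F" for F
      using A[OF that] by simp
  qed
  ultimately show ?thesis by (simp add: abs_le_iff)
qed

lemma sum_int_powr_bounded:
  fixes r :: real
  assumes "1 / 2 < r"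
  obtains Z where "\<And>F :: int set. finite F \<Longrightarrow> (\<Sum>j\<in>F. (1 + (of_int j)\<^sup>2) powr (- r)) \<le> Z"
proof -
  define g :: "nat \<Rightarrow> real" where "g m = (1 + (real m)\<^sup>2) powr (- r)" for m
  have "summable g"
  proof (rule summable_comparison_test)
    show "summable (\<lambda>m. real m powr (- 2 * r))" using assms by (simp add: summable_real_powr_iff)
    have "norm (g m) \<le> real m powr (- 2 * r)" if "m \<ge> 1" for m
    proof -
      have "real m powr (- 2 * r) = ((real m)\<^sup>2) powr (- r)"
        using that by (simp add: powr_powr flip: powr_numeral)
      moreover have "g m \<le> ((real m)\<^sup>2) powr (- r)"
        unfolding g_def using that assms by (intro powr_mono2') auto
      ultimately show ?thesis by (simp add: g_def)
    qed
    then show "\<exists>N. \<forall>m\<ge>N. norm (g m) \<le> real m powr (- 2 * r)" by blast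
  qed
  have g0: "0 \<le> g m" for m by (simp add: g_def)
  have bound: "(\<Sum>m\<in>G. g m) \<le> suminf g" if "finite G" for G
    using sum_le_suminf[OF \<open>summable g\<close> that] g0 by simp
  have "(\<Sum>j\<in>F. (1 + (of_int j)\<^sup>2) powr (- r)) \<le> 2 * suminf g" if F: "finite F" for F :: "int set"
  proof -
    have "(\<Sum>j\<in>F. (1 + (real_of_int j)\<^sup>2) powr (- r)) = (\<Sum>j\<in>F. g (nat \<bar>j\<bar>))"
      by (simp add: g_def)
    also have "\<dots> = (\<Sum>j\<in>F \<inter> {0..}. g (nat \<bar>j\<bar>)) + (\<Sum>j\<in>F \<inter> {..<0}. g (nat \<bar>j\<bar>))"
      using F by (subst sum.union_disjoint[symmetric]) (auto intro!: sum.cong)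
    also have "(\<Sum>j\<in>F \<inter> {0..}. g (nat \<bar>j\<bar>)) = sum g ((\<lambda>j. nat \<bar>j\<bar>) ` (F \<inter> {0..}))"
      by (subst sum.reindex) (auto simp: inj_on_def)
    also have "(\<Sum>j\<in>F \<inter> {..<0}. g (nat \<bar>j\<bar>)) = sum g ((\<lambda>j. nat \<bar>j\<bar>) ` (F \<inter> {..<0}))"
      by (subst sum.reindex) (auto simp: inj_on_def)
    finally show ?thesis
      using bound[of "(\<lambda>j. nat \<bar>j\<bar>) ` (F \<inter> {0..})"] bound[of "(\<lambda>j. nat \<bar>j\<bar>) ` (F \<inter> {..<0})"] F by simp
  qed
  then show thesis by (rule that)
qed

text \<open>
  As $1 + |k|^2$ is at least $1 + k_i^2$ for each of the $n$ indices $i$, the summand is at most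
  $\prod_i (1 + k_i^2)^{-s/n}$, and the sum factorizes into one-dimensional sums with $2s/n > 1$.
\<close>

lemma sum_lattice_powr_bounded:
  fixes s :: real
  assumes s: "real CARD('n) / 2 < s"
  obtains Z where "\<And>F :: (int^'n) set. finite F \<Longrightarrow>
    (\<Sum>k\<in>F. (1 + (\<Sum>i\<in>UNIV. (of_int (k $ i))\<^sup>2)) powr (- s)) \<le> Z"
proof -
  define n where "n = real CARD('n)"
  have n: "n > 0" by (simp add: n_def)
  define r where "r = s / n"
  have r: "1 / 2 < r" using s n by (simp add: r_def n_def field_simps)
  define a where "a j = (1 + (real_of_int j)\<^sup>2) powr (- r)" for j
  have a0: "0 \<le> a j" for j by (simp add: a_def)
  obtain Z where Z: "\<And>F. finite F \<Longrightarrow> sum a F \<le> Z"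
    using sum_int_powr_bounded[OF r] unfolding a_def by metis
  have "(\<Sum>k\<in>F. (1 + (\<Sum>i\<in>UNIV. (of_int (k $ i))\<^sup>2)) powr (- s)) \<le> Z ^ CARD('n)"
    if F: "finite F" for F :: "(int^'n) set"
  proof -
    have term_le: "(1 + (\<Sum>i\<in>UNIV. (real_of_int (k $ i))\<^sup>2)) powr (- s) \<le> (\<Prod>i\<in>UNIV. a (k $ i))" for k :: "int^'n"
    proof -
      define W where "W = 1 + (\<Sum>i\<in>UNIV. (real_of_int (k $ i))\<^sup>2)"
      have W: "W > 0" unfolding W_def by (intro add_pos_nonneg sum_nonneg) auto
      have "W powr (- s) = (W powr (- r)) powr n" using n W by (simp add: powr_powr r_def)
      also have "\<dots> = (\<Prod>i\<in>(UNIV :: 'n set). W powr (- r))"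
        using W by (simp add: n_def powr_realpow)
      also have "\<dots> \<le> (\<Prod>i\<in>UNIV. a (k $ i))"
      proof (rule prod_mono)
        fix i
        have "(real_of_int (k $ i))\<^sup>2 \<le> (\<Sum>i\<in>UNIV. (real_of_int (k $ i))\<^sup>2)"
          by (rule member_le_sum) auto
        then have "W powr (- r) \<le> a (k $ i)"
          unfolding a_def W_def using r by (intro powr_mono2') (auto intro: add_pos_nonneg)
        then show "0 \<le> W powr (- r) \<and> W powr (- r) \<le> a (k $ i)" by simp
      qed
      finally show ?thesis by (simp add: W_def)
    qed
    define B where "B = (\<Union>k\<in>F. range (($) k))"
    have B: "finite B" using F by (simp add: B_def)
    have "(\<Sum>k\<in>F. (1 + (\<Sum>i\<in>UNIV. (real_of_int (k $ i))\<^sup>2)) powr (- s)) \<le> (\<Sum>k\<in>F. \<Prod>i\<in>UNIV. a (k $ i))"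
      by (rule sum_mono) (rule term_le)
    also have "\<dots> = (\<Sum>g\<in>($) ` F. \<Prod>i\<in>UNIV. a (g i))"
      by (subst sum.reindex) (auto simp: inj_on_def vec_eq_iff)
    also have "\<dots> \<le> (\<Sum>g\<in>PiE (UNIV :: 'n set) (\<lambda>_. B). \<Prod>i\<in>UNIV. a (g i))"
    proof (rule sum_mono2)
      show "($) ` F \<subseteq> PiE UNIV (\<lambda>_. B)" by (auto simp: B_def)
    qed (auto intro!: finite_PiE B prod_nonneg a0)
    also have "\<dots> = (\<Prod>i\<in>(UNIV :: 'n set). \<Sum>j\<in>B. a j)"
      by (rule prod_sum_PiE[symmetric]) (auto simp: B)
    also have "\<dots> \<le> Z ^ CARD('n)" using Z[OF B] by (simp add: power_mono sum_nonneg a0)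
    finally show ?thesis .
  qed
  then show thesis by (rule that)
qed

lemma sobolev_term_nonneg: "0 \<le> sobolev_term s f k"
  by (simp add: sobolev_term_def)

lemma sobolev_sup_bound:
  fixes s :: real
  assumes s: "real CARD('n) / 2 < s"
  obtains C where "0 \<le> C" "\<And>f :: real^'n \<Rightarrow> real. continuous_on UNIV f \<Longrightarrow> torus_periodic f \<Longrightarrow>
    sobolev_term s f summable_on UNIV \<Longrightarrow> (\<forall>x. \<bar>f x\<bar> \<le> C * sobolev_norm s f)"
proof -
  obtain Z where Z: "\<And>F :: (int^'n) set. finite F \<Longrightarrow>
    (\<Sum>k\<in>F. (1 + (\<Sum>i\<in>UNIV. (of_int (k $ i))\<^sup>2)) powr (- s)) \<le> Z"
    using sum_lattice_powr_bounded[OF s] by blast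
  have Z0: "0 \<le> Z" using Z[of "{}"] by simp
  have "\<bar>f x\<bar> \<le> sqrt Z * sobolev_norm s f"
    if f: "continuous_on UNIV f" "torus_periodic f" "sobolev_term s f summable_on UNIV"
    for f :: "real^'n \<Rightarrow> real" and x
  proof (rule fourier_sum_bounds_function[OF f(1,2)])
    fix F :: "(int^'n) set" assume F: "finite F"
    define W where "W k = 1 + (\<Sum>i\<in>UNIV. (real_of_int (k $ i))\<^sup>2)" for k :: "int^'n"
    have W: "W k > 0" for k unfolding W_def by (intro add_pos_nonneg sum_nonneg) auto
    have "(\<Sum>k\<in>F. norm (fourier_coeff f k)) =
        (\<Sum>k\<in>F. W k powr (- s / 2) * (W k powr (s / 2) * norm (fourier_coeff f k)))"
      using W by (intro sum.cong refl) (simp add: mult.assoc[symmetric] powr_add[symmetric] less_imp_neq[symmetric])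
    also have "\<dots> \<le> sqrt ((\<Sum>k\<in>F. (W k powr (- s / 2))\<^sup>2) * (\<Sum>k\<in>F. (W k powr (s / 2) * norm (fourier_coeff f k))\<^sup>2))"
      by (rule real_le_rsqrt) (rule Cauchy_Schwarz_ineq_sum)
    also have "(\<Sum>k\<in>F. (W k powr (- s / 2))\<^sup>2) = (\<Sum>k\<in>F. W k powr (- s))"
      by (simp add: power2_eq_square powr_add[symmetric])
    also have "(\<Sum>k\<in>F. (W k powr (s / 2) * norm (fourier_coeff f k))\<^sup>2) = (\<Sum>k\<in>F. sobolev_term s f k)"
      by (simp add: power_mult_distrib sobolev_term_def W_def power2_eq_square[of "_ powr _"] powr_add[symmetric])
    also have "sqrt ((\<Sum>k\<in>F. W k powr (- s)) * (\<Sum>k\<in>F. sobolev_term s f k)) \<le> sqrt (Z * (\<Sum>\<^sub>\<infinity>k. sobolev_term s f k))"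
      using Z[OF F] Z0 finite_sum_le_infsum[OF f(3) F] sobolev_term_nonneg
      by (intro real_sqrt_le_mono mult_mono sum_nonneg) (auto simp: W_def)
    also have "\<dots> = sqrt Z * sobolev_norm s f" by (simp add: real_sqrt_mult sobolev_norm_def)
    finally show "(\<Sum>k\<in>F. norm (fourier_coeff f k)) \<le> sqrt Z * sobolev_norm s f" .
  qed
  then show thesis using that[of "sqrt Z"] Z0 by simp
qed

text \<open>
  \<open>sobolev_norm\<close> takes the default value 0 if the sum diverges; summability is what makes a small norm of a
  difference meaningful.
\<close>

lemma sobolev_term_diff_summable:
  fixes f g :: "real^'n \<Rightarrow> real"
  assumes "continuous_on UNIV f" "continuous_on UNIV g"
    and f: "sobolev_term s f summable_on UNIV" and g: "sobolev_term s g summable_on UNIV"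
  shows "sobolev_term s (\<lambda>x. f x - g x) summable_on UNIV"
proof (rule summable_on_comparison_test)
  show "(\<lambda>k. 2 * sobolev_term s f k + 2 * sobolev_term s g k) summable_on UNIV"
    by (intro summable_on_add summable_on_cmult_right f g)
  fix k :: "int^'n"
  have "(norm (fourier_coeff f k - fourier_coeff g k))\<^sup>2 \<le> (norm (fourier_coeff f k) + norm (fourier_coeff g k))\<^sup>2"
    by (intro power_mono norm_triangle_ineq4) auto
  also have "\<dots> \<le> 2 * (norm (fourier_coeff f k))\<^sup>2 + 2 * (norm (fourier_coeff g k))\<^sup>2"
    using sum_squares_bound[of "norm (fourier_coeff f k)" "norm (fourier_coeff g k)"] by (simp add: power2_sum)
  finally have "(1 + (\<Sum>i\<in>UNIV. (of_int (k $ i))\<^sup>2)) powr s * (norm (fourier_coeff f k - fourier_coeff g k))\<^sup>2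
      \<le> (1 + (\<Sum>i\<in>UNIV. (of_int (k $ i))\<^sup>2)) powr s * (2 * (norm (fourier_coeff f k))\<^sup>2 + 2 * (norm (fourier_coeff g k))\<^sup>2)"
    by (intro mult_left_mono) auto
  then show "sobolev_term s (\<lambda>x. f x - g x) k \<le> 2 * sobolev_term s f k + 2 * sobolev_term s g k"
    unfolding sobolev_term_def fourier_coeff_diff[OF assms(1,2)] by (simp add: algebra_simps)
qed (simp add: sobolev_term_nonneg)

lemma C0_sobolev_imp_jointly_continuous:
  fixes u :: "real \<Rightarrow> real^'n \<Rightarrow> real"
  assumes s: "real CARD('n) / 2 < s" and u: "C0_sobolev s I u"
    and cont: "\<And>t. t \<in> I \<Longrightarrow> continuous_on UNIV (u t)" and per: "\<And>t. t \<in> I \<Longrightarrow> torus_periodic (u t)"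
  shows "continuous_on (I \<times> UNIV) (\<lambda>(t, x). u t x)"
  unfolding continuous_on_def
proof
  fix z :: "real \<times> (real^'n)" assume "z \<in> I \<times> UNIV"
  then obtain t x where z: "z = (t, x)" and t: "t \<in> I" by auto
  obtain C where C: "0 \<le> C" "\<And>f :: real^'n \<Rightarrow> real. continuous_on UNIV f \<Longrightarrow> torus_periodic f \<Longrightarrow>
    sobolev_term s f summable_on UNIV \<Longrightarrow> (\<forall>x. \<bar>f x\<bar> \<le> C * sobolev_norm s f)"
    using sobolev_sup_bound[OF s] by blast
  have bound: "\<bar>u \<tau> \<xi> - u t \<xi>\<bar> \<le> C * sobolev_norm s (\<lambda>x. u \<tau> x - u t x)" if \<tau>: "\<tau> \<in> I" for \<tau> \<xi>
  proof -
    have sm: "sobolev_term s (u \<tau>) summable_on UNIV" if "\<tau> \<in> I" for \<tau>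
      using u that by (auto simp: C0_sobolev_def sobolev_def)
    show ?thesis
      using C(2)[of "\<lambda>x. u \<tau> x - u t x"] sobolev_term_diff_summable[OF cont cont sm sm, OF \<tau> t \<tau> t]
        cont[OF t] cont[OF \<tau>] per[OF t] per[OF \<tau>]
      by (auto simp: torus_periodic_def intro: continuous_on_diff)
  qed
  define N where "N \<tau> = C * sobolev_norm s (\<lambda>x. u \<tau> x - u t x)" for \<tau>
  have "fourier_coeff (\<lambda>x::real^'n. 0) k = 0" for k by (simp add: fourier_coeff_def)
  then have "N t = 0" by (simp add: N_def sobolev_norm_def sobolev_term_def)
  moreover have "(N \<longlongrightarrow> 0) (at t within I)"
    using u t unfolding N_def[abs_def] C0_sobolev_def by (intro tendsto_mult_right_zero) auto
  ultimately have "continuous (at (fst z) within fst ` (I \<times> (UNIV :: (real^'n) set))) N"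
    by (simp add: continuous_within z)
  then have "continuous (at z within I \<times> UNIV) (\<lambda>w. N (fst w))"
    by (intro continuous_within_compose2[where f = fst and g = N] continuous_fst continuous_ident)
  then have "((\<lambda>w. N (fst w)) \<longlongrightarrow> 0) (at z within I \<times> UNIV)"
    using \<open>N t = 0\<close> by (simp add: continuous_within z)
  then have "((\<lambda>w. u (fst w) (snd w) - u t (snd w)) \<longlongrightarrow> 0) (at z within I \<times> UNIV)"
    by (rule Lim_null_comparison[rotated])
      (use bound in \<open>auto simp: eventually_at_filter N_def intro!: always_eventually\<close>)
  moreover have "((\<lambda>w. u t (snd w)) \<longlongrightarrow> u t x) (at z within I \<times> UNIV)"
  proof (rule isCont_tendsto_compose[where g = "u t" and f = snd])
    show "isCont (u t) x" using cont[OF t] by (simp add: continuous_on_eq_continuous_at)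
    show "(snd \<longlongrightarrow> x) (at z within I \<times> UNIV)" 
      using tendsto_snd[OF tendsto_ident_at, of z] by (simp add: z)
  qed
  ultimately have "((\<lambda>w. (u (fst w) (snd w) - u t (snd w)) + u t (snd w)) \<longlongrightarrow> 0 + u t x) (at z within I \<times> UNIV)"
    by (rule tendsto_add)
  then show "((\<lambda>(t, x). u t x) \<longlongrightarrow> (case z of (t, x) \<Rightarrow> u t x)) (at z within I \<times> UNIV)"
    by (simp add: z case_prod_unfold)
qed

section \<open>Propagation of increments in time\<close>

text \<open>
  This is \<open>DN_comparison_at_contact\<close> for \<open>h (x + v)\<close> and \<open>h x\<close> raised by the maximal increment. The terms
  \<open>+ 0\<close> in the proof bring both functions into the form \<open>h (x + a) + b\<close>, to which the translation lemmas apply.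
\<close>

lemma DN_le_at_maximal_increment:
  fixes h :: "real^'n \<Rightarrow> real"
  assumes h: "continuous_on UNIV h" "torus_periodic h" and DN: "has_DN h h g"
    and max: "\<And>x. h (x + v) - h x \<le> h (x\<^sub>0 + v) - h x\<^sub>0"
  shows "g x\<^sub>0 \<le> g (x\<^sub>0 + v)"
proof -
  obtain \<phi> where \<phi>: "harmonic_extension h h \<phi>"
    and d: "\<And>x. \<exists>p q grad_h. (GDERIV h x :> grad_h) \<and>
          (\<phi> has_derivative (\<lambda>w. (p, q) \<bullet> w)) (at (x, h x) within closed_fluid_domain h) \<and>
          g x = q - grad_h \<bullet> p"
    using DN unfolding has_DN_def by blast
  have tr: "\<phi> (x, h x) = h x" for x using \<phi> by (simp add: harmonic_extension_def)
  note fin = harmonic_extension_imp_finite_energy_harmonic[OF h \<phi>]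
  define M where "M = h (x\<^sub>0 + v) - h x\<^sub>0"
  have shift: "GDERIV (\<lambda>x. h (x + a) + b) x\<^sub>0 :> G"
      "((\<lambda>z. \<phi> (z + (a, - b)) + b) has_derivative (\<lambda>w. (p, q) \<bullet> w))
        (at (x\<^sub>0, h (x\<^sub>0 + a) + b) within closed_fluid_domain (\<lambda>x. h (x + a) + b))"
    if "GDERIV h (x\<^sub>0 + a) :> G"
      "(\<phi> has_derivative (\<lambda>w. (p, q) \<bullet> w)) (at (x\<^sub>0 + a, h (x\<^sub>0 + a)) within closed_fluid_domain h)" for a b G p q
  proof -
    have "((\<lambda>x. x + a) has_derivative (\<lambda>c. c)) (at x\<^sub>0)" by (auto intro!: derivative_eq_intros)
    from has_derivative_compose[OF this that(1)[unfolded gderiv_def]]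
    show "GDERIV (\<lambda>x. h (x + a) + b) x\<^sub>0 :> G"
      unfolding gderiv_def by (auto intro!: derivative_eq_intros)
    define S where "S = closed_fluid_domain (\<lambda>x. h (x + a) + b)"
    have im: "(\<lambda>z. z + (a, - b)) ` S \<subseteq> closed_fluid_domain h"
      by (auto simp: S_def closed_fluid_domain_def)
    define z where "z = (x\<^sub>0, h (x\<^sub>0 + a) + b)"
    have z: "z + (a, - b) = (x\<^sub>0 + a, h (x\<^sub>0 + a))" by (simp add: z_def)
    have "((\<lambda>z. z + (a, - b)) has_derivative (\<lambda>c. c)) (at z within S)"
      by (auto intro!: derivative_eq_intros)
    from has_derivative_in_compose[OF this has_derivative_subset[OF that(2)[folded z] im]]
    have "((\<lambda>z. \<phi> (z + (a, - b))) has_derivative (\<lambda>w. (p, q) \<bullet> w)) (at z within S)" .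
    from has_derivative_add[OF this has_derivative_const[of b]]
    show "((\<lambda>z. \<phi> (z + (a, - b)) + b) has_derivative (\<lambda>w. (p, q) \<bullet> w))
        (at (x\<^sub>0, h (x\<^sub>0 + a) + b) within closed_fluid_domain (\<lambda>x. h (x + a) + b))"
      by (simp add: S_def z_def)
  qed
  obtain p1 q1 G1 where 1: "GDERIV h (x\<^sub>0 + v) :> G1"
      "(\<phi> has_derivative (\<lambda>w. (p1, q1) \<bullet> w)) (at (x\<^sub>0 + v, h (x\<^sub>0 + v)) within closed_fluid_domain h)"
      "g (x\<^sub>0 + v) = q1 - G1 \<bullet> p1" using d by blast
  obtain p2 q2 G2 where 2: "GDERIV h (x\<^sub>0 + 0) :> G2"
      "(\<phi> has_derivative (\<lambda>w. (p2, q2) \<bullet> w)) (at (x\<^sub>0 + 0, h (x\<^sub>0 + 0)) within closed_fluid_domain h)"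
      "g (x\<^sub>0 + 0) = q2 - G2 \<bullet> p2" using d by blast
  have "q2 - G2 \<bullet> p2 \<le> q1 - G1 \<bullet> p1"
  proof (rule DN_comparison_at_contact)
    show "finite_energy_harmonic (\<lambda>x. h (x + v) + 0) (\<lambda>z. \<phi> (z + (v, - 0)) + 0)"
      "finite_energy_harmonic (\<lambda>x. h (x + 0) + M) (\<lambda>z. \<phi> (z + (0, - M)) + M)"
      by (rule finite_energy_harmonic_shift[OF fin])+
    show "\<phi> ((x, h (x + v) + 0) + (v, - 0)) + 0 = h (x + v) + 0"
      "\<phi> ((x, h (x + 0) + M) + (0, - M)) + M = h (x + 0) + M" for x
      using tr by simp_all
    show "h (x + v) + 0 \<le> h (x + 0) + M" for x using max[of x] by (simp add: M_def)
    show "h (x\<^sub>0 + v) + 0 = h (x\<^sub>0 + 0) + M" by (simp add: M_def)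
  qed (rule shift[OF 1(1,2)] shift[OF 2(1,2)])+
  then show ?thesis using 1(3) 2(3) by simp
qed

text \<open>
  Subtracting $\epsilon t$ makes the maximum principle strict: it excludes a maximum at a positive
  time, where the equation only gives a non-positive time derivative of the increment.
\<close>

lemma increment_bound_propagates:
  fixes h :: "real \<Rightarrow> real^'n \<Rightarrow> real"
  assumes T: "0 < T" and reg: "regular_solution T h"
    and init: "\<And>x. h 0 (x + v) - h 0 x \<le> B" and t: "t \<in> {0..T}"
  shows "h t (x + v) - h t x \<le> B"
proof (rule ccontr)
  assume neg: "\<not> h t (x + v) - h t x \<le> B"
  have per: "torus_periodic (h \<tau>)" and cont: "continuous_on UNIV (h \<tau>)" if "\<tau> \<in> {0..T}" for \<tau>
    using reg that by (auto simp: regular_solution_def)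
  obtain s where s: "s > CARD('n) / 2 + 1" "C0_sobolev s {0..T} h"
    using reg unfolding regular_solution_def by blast
  have joint: "continuous_on ({0..T} \<times> UNIV) (\<lambda>(t, x). h t x)"
    by (rule C0_sobolev_imp_jointly_continuous[OF _ s(2) cont per]) (use s(1) in auto)
  \<comment> \<open>So small that the increment minus \<open>\<epsilon> * t\<close> still exceeds \<open>B\<close> at the given point.\<close>
  define \<epsilon> where "\<epsilon> = (h t (x + v) - h t x - B) / (2 * T)"
  have \<epsilon>: "\<epsilon> > 0" using neg T by (simp add: \<epsilon>_def)
  define w where "w p = h (fst p) (snd p + v) - h (fst p) (snd p) - \<epsilon> * fst p" for p
  have wper: "w (\<tau>, x + lattice_vec k) = w (\<tau>, x)" if "\<tau> \<in> {0..T}" for \<tau> x k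
    using torus_periodicD[OF per[OF that], of "x + v" k] torus_periodicD[OF per[OF that], of x k]
    by (simp add: w_def add_ac)
  have cw: "continuous_on ({0..T} \<times> torus_cell) w"
  proof -
    have "continuous_on ({0..T} \<times> torus_cell) (\<lambda>p. h (fst p) (snd p + v))"
    proof -
      have "continuous_on ({0..T} \<times> torus_cell) (\<lambda>p. (fst p, snd p + v))"
        by (intro continuous_intros)
      from continuous_on_compose2[OF joint this] show ?thesis by force
    qed
    moreover have "continuous_on ({0..T} \<times> torus_cell) (\<lambda>p. h (fst p) (snd p))"
      using continuous_on_subset[OF joint, of "{0..T} \<times> torus_cell"] by (auto simp: case_prod_unfold)
    ultimately show ?thesis unfolding w_def[abs_def] by (intro continuous_intros)
  qed
  obtain k where k: "x + lattice_vec k \<in> torus_cell" using torus_cell_representative by blast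
  have cp: "compact ({0..T} \<times> (torus_cell :: (real^'n) set))"
    by (intro compact_Times) (auto simp: torus_cell_eq_cbox)
  obtain z where z: "z \<in> {0..T} \<times> torus_cell" "\<forall>p\<in>{0..T} \<times> torus_cell. w p \<le> w z"
    using continuous_attains_sup[OF cp _ cw] k t by blast
  obtain t0 x0 where z0: "z = (t0, x0)" and t0: "t0 \<in> {0..T}" using z(1) by auto
  have maxw: "w (\<tau>, \<xi>) \<le> w (t0, x0)" if "\<tau> \<in> {0..T}" for \<tau> \<xi>
  proof -
    obtain l where "\<xi> + lattice_vec l \<in> torus_cell" using torus_cell_representative by blast
    then have "w (\<tau>, \<xi> + lattice_vec l) \<le> w (t0, x0)" using z(2) that by (auto simp: z0)
    then show ?thesis unfolding wper[OF that] .
  qed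
  have "\<epsilon> * t \<le> \<epsilon> * T" using \<epsilon> t by simp
  also have "\<dots> < h t (x + v) - h t x - B" using neg T by (simp add: \<epsilon>_def)
  finally have "B < w (t, x)" by (simp add: w_def)
  then have "B < w (t0, x0)" using maxw[OF t, of x] by simp
  moreover have "w (0, x0) \<le> B" using init[of x0] by (simp add: w_def)
  ultimately have "t0 \<noteq> 0" by auto
  then have t0pos: "0 < t0" using t0 by simp
  obtain g where g: "has_DN (h t0) (h t0) g"
    and dt: "\<And>x. \<exists>dh. ((\<lambda>\<tau>. h \<tau> x) has_real_derivative dh) (at t0 within {0..T}) \<and> dh + g x = 0"
    using reg t0 unfolding regular_solution_def by blast
  have dt': "((\<lambda>\<tau>. h \<tau> x) has_real_derivative - g x) (at t0 within {0..T})" for x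
    using dt[of x] by (metis add_eq_0_iff2)
  have "h t0 (\<xi> + v) - h t0 \<xi> \<le> h t0 (x0 + v) - h t0 x0" for \<xi>
    using maxw[OF t0, of \<xi>] by (simp add: w_def)
  then have "g x0 \<le> g (x0 + v)"
    by (rule DN_le_at_maximal_increment[OF cont[OF t0] per[OF t0] g])
  then have neg: "- g (x0 + v) - - g x0 - \<epsilon> < 0" using \<epsilon> by simp
  have "((\<lambda>\<tau>. w (\<tau>, x0)) has_real_derivative - g (x0 + v) - - g x0 - \<epsilon>) (at t0 within {0..T})"
    unfolding w_def fst_conv snd_conv
    by (intro DERIV_diff dt') (auto intro!: derivative_eq_intros)
  from has_real_derivative_neg_dec_left[OF this neg]
  obtain d where d: "d > 0" "\<And>\<delta>. \<delta> > 0 \<Longrightarrow> t0 - \<delta> \<in> {0..T} \<Longrightarrow> \<delta> < d \<Longrightarrow> w (t0, x0) < w (t0 - \<delta>, x0)"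
    by blast
  define \<delta> where "\<delta> = min d t0 / 2"
  have "\<delta> > 0" "\<delta> < d" "t0 - \<delta> \<in> {0..T}" using d(1) t0pos t0 by (auto simp: \<delta>_def min_def)
  then show False using d(2)[of \<delta>] maxw[of "t0 - \<delta>" x0] by simp
qed

text \<open>
  Both \<open>torus_eq\<close> and \<open>torus_dist\<close> depend on the difference of the points only, so that a modulus of
  continuity amounts to one bound for the increments by each vector.
\<close>

theorem proposition2p9:
  fixes h :: "real \<Rightarrow> real^'n \<Rightarrow> real" and \<omega> :: "real \<Rightarrow> real" and T t :: real
  assumes "0 < T"
    and "regular_solution T h"
    and "modulus_of_continuity \<omega> (h 0)"
    and "t \<in> {0..T}"
  shows "modulus_of_continuity \<omega> (h t)"
proof -
  have \<omega>: "mono_on {0<..} \<omega>" "\<forall>r>0. 0 < \<omega> r"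
    and init: "\<And>x\<^sub>1 x\<^sub>2. \<not> torus_eq x\<^sub>1 x\<^sub>2 \<Longrightarrow> \<bar>h 0 x\<^sub>1 - h 0 x\<^sub>2\<bar> \<le> \<omega> (torus_dist x\<^sub>1 x\<^sub>2)"
    using assms(3) unfolding modulus_of_continuity_def by blast+
  have "\<bar>h t x\<^sub>1 - h t x\<^sub>2\<bar> \<le> \<omega> (torus_dist x\<^sub>1 x\<^sub>2)" if ne: "\<not> torus_eq x\<^sub>1 x\<^sub>2" for x\<^sub>1 x\<^sub>2
  proof -
    define v where "v = x\<^sub>1 - x\<^sub>2"
    have "h 0 (x + v) - h 0 x \<le> \<omega> (torus_dist x\<^sub>1 x\<^sub>2)" for x
      using init[of "x + v" x] ne by (simp add: torus_eq_def torus_dist_def v_def)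
    from increment_bound_propagates[OF assms(1,2) this assms(4), of x\<^sub>2]
    have "h t x\<^sub>1 - h t x\<^sub>2 \<le> \<omega> (torus_dist x\<^sub>1 x\<^sub>2)" by (simp add: v_def)
    moreover have "h 0 (x + - v) - h 0 x \<le> \<omega> (torus_dist x\<^sub>1 x\<^sub>2)" for x
      using init[of x "x + - v"] ne by (simp add: torus_eq_def torus_dist_def v_def)
    from increment_bound_propagates[OF assms(1,2) this assms(4), of x\<^sub>1]
    have "h t x\<^sub>2 - h t x\<^sub>1 \<le> \<omega> (torus_dist x\<^sub>1 x\<^sub>2)" by (simp add: v_def)
    ultimately show ?thesis by (simp add: abs_le_iff)
  qed
  then show ?thesis using \<omega> unfolding modulus_of_continuity_def by blast
qed

end
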